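(* Let $\mathcal{L}: \sum_{i\in[k]} c_i x_i = 0$ be a homogeneous linear equation with $k\ge 3$ and $c_1,\dots,c_k\in\mathbb{Z}\setminus\{0\}$. Then the following are equivalent: (a) For every $\delta>0$ there exists $\varepsilon>0$ such that $d(\mathcal{L},\varepsilon)<\delta$; i.e., every solution-free set $A$ of $\mathcal{L}$ in $\mathbb{F}_p$ with $\alpha(\mathrm{Cay}_{\mathbb{F}_p}(A))=o(p)$ has size $o(p)$ (as $p\to\infty$ over primes). (b) There exists a non-empty set $S\subseteq[k]$ such that $\sum_{s\in S} c_s=0$.
   Context: For a prime $p$, a set $A\subseteq\mathbb{F}_p$ is solution-free for $\mathcal{L}$ if there is no $k$-tuple $(a_1,\dots,a_k)\in A^k$ of pairwise distinct elements with $\sum_i c_i a_i=0$ in $\mathbb{F}_p$. The Cayley graph $\mathrm{Cay}_{\mathbb{F}_p}(A)$ is the digraph on vertex set $\mathbb{F}_p$ with an arc $\vec{uv}$ iff $v-u\in A$. For a digraph $D$, $\alpha(D)$ denotes the independence number of its underlying undirected graph. For $\varepsilon>0$, $D(\mathcal{L},\varepsilon,p)$ is the maximum size of a solution-free set $A$ of $\mathcal{L}$ in $\mathbb{F}_p$ with $\alpha(\mathrm{Cay}_{\mathbb{F}_p}(A))\le\varepsilon p$, and $d(\mathcal{L},\varepsilon):=\limsup_{p\to\infty,\ p\text{ prime}} D(\mathcal{L},\varepsilon,p)/p$. *)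

theory Defs
  imports
    Complex_Main
    "HOL-Library.Extended_Real"
    "HOL-Library.Liminf_Limsup"
    "HOL-Number_Theory.Number_Theory"
    "Graph_Theory.Digraph_Component"
begin

text \<open>
  Since \<open>p\<close> varies, the field with \<open>p\<close> elements is modelled by its least non-negative
  residues, with arithmetic carried out in the integers modulo \<open>p\<close>.
\<close>

definition residue_set :: "nat \<Rightarrow> int set" where
  "residue_set p = {0..<int p}"

definition solution_free :: "nat \<Rightarrow> (nat \<Rightarrow> int) \<Rightarrow> nat \<Rightarrow> int set \<Rightarrow> bool" where
  "solution_free k c p A \<longleftrightarrow>
     \<not> (\<exists>a. (\<forall>i\<in>{1..k}. a i \<in> A) \<and> inj_on a {1..k} \<and>
            [(\<Sum>i\<in>{1..k}. c i * a i) = 0] (mod int p))"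

definition cayley_digraph :: "nat \<Rightarrow> int set \<Rightarrow> int pair_pre_digraph" where
  "cayley_digraph p A =
     \<lparr> pverts = residue_set p,
       parcs = {(u, v). u \<in> residue_set p \<and> v \<in> residue_set p \<and> (v - u) mod int p \<in> A} \<rparr>"

text \<open>
  Only pairs of distinct vertices are tested: if \<open>0 \<in> A\<close>, then every vertex of the Cayley
  digraph carries a loop, and these loops are not part of the underlying undirected graph.
\<close>

definition independent_set :: "('a, 'b) pre_digraph \<Rightarrow> 'a set \<Rightarrow> bool" where
  "independent_set G S \<longleftrightarrow>
     S \<subseteq> verts G \<and> (\<forall>u\<in>S. \<forall>v\<in>S. u \<noteq> v \<longrightarrow> \<not> u \<rightarrow>\<^bsub>G\<^esub> v)"

text \<open>The operation \<open>mk_symmetric\<close> yields the underlying undirected graph (as a symmetric digraph).\<close>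

definition independence_number :: "('a, 'b) pre_digraph \<Rightarrow> nat" where
  "independence_number G = Max (card ` {S. independent_set (with_proj (mk_symmetric G)) S})"

text \<open>For a prime \<open>p\<close> without any admissible set the maximum is set to be \<open>0\<close>.\<close>

definition max_solution_free :: "nat \<Rightarrow> (nat \<Rightarrow> int) \<Rightarrow> real \<Rightarrow> nat \<Rightarrow> nat" where
  "max_solution_free k c \<epsilon> p =
     Max (insert 0 (card ` {A. A \<subseteq> residue_set p \<and> solution_free k c p A \<and>
       real (independence_number (with_proj (cayley_digraph p A))) \<le> \<epsilon> * real p}))"

definition solution_free_density :: "nat \<Rightarrow> (nat \<Rightarrow> int) \<Rightarrow> real \<Rightarrow> ereal" where
  "solution_free_density k c \<epsilon> =
     Limsup (inf sequentially (principal {p. prime p}))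
       (\<lambda>p. ereal (real (max_solution_free k c \<epsilon> p) / real p))"

end

theory Submission
  imports Defs
begin

text \<open>
  If no sub-sum of the coefficients vanishes, take a short interval around a small multiple of \<open>p\<close>
  together with the differences \<open>M ^ j - M ^ i\<close>, \<open>i < j \<le> N\<close>.  All its elements are so small that a
  solution would be a solution in the integers.  If it uses elements of the interval, their coefficients
  give a non-zero leading term; otherwise the coefficients belonging to the highest power of \<open>M\<close> do.

  Conversely, let \<open>c\<close> sum to \<open>0\<close> over \<open>S\<close>.  A Roth-type theorem for the translation-invariant equation
  restricted to \<open>S\<close>, proved by Szemeredi's elementary cube argument, yields a pattern \<open>t\<close> with
  \<open>(\<Sum>s\<in>S. c s * t s) = 0\<close> such that \<open>z + t s \<in> A\<close> for all \<open>s \<in> S\<close> holds for a positive proportion of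
  the \<open>z\<close>.  Call the set of these points \<open>I\<close>.  In the Cayley graph of any dilate of \<open>A\<close>, only few
  vertices of \<open>I\<close> have small out-degree within \<open>I\<close>, because a set of such vertices contains a
  proportional independent set.  Hence some \<open>z0 \<in> I\<close> starts a walk in \<open>I\<close> with one step
  \<open>- (c i / c s0) * r i\<close>, \<open>r i \<in> A\<close>, for each index \<open>i\<close> outside \<open>S\<close>.  Moving the \<open>s0\<close>-th point of the pattern
  from \<open>z0\<close> to the end of the walk compensates the terms \<open>c i * r i\<close>.
\<close>

section \<open>Cayley graphs and densities\<close>

lemma verts_cayley_symmetric:
  "verts (with_proj (mk_symmetric (with_proj (cayley_digraph p A)))) = {0..<int p}"
  unfolding mk_symmetric_def cayley_digraph_def residue_set_def with_proj_def
  by (simp only: pre_digraph.simps pair_pre_digraph.simps)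

lemma dominates_cayley_symmetric_iff:
  "u \<rightarrow>\<^bsub>with_proj (mk_symmetric (with_proj (cayley_digraph p A)))\<^esub> v \<longleftrightarrow>
    u \<in> {0..<int p} \<and> v \<in> {0..<int p} \<and> ((v - u) mod int p \<in> A \<or> (u - v) mod int p \<in> A)"
  unfolding mk_symmetric_def cayley_digraph_def residue_set_def with_proj_def arcs_ends_def
    arc_to_ends_def
  apply (simp only: pre_digraph.simps pair_pre_digraph.simps)
  apply (simp only: image_iff UN_iff Bex_def mem_Collect_eq split_paired_Ex prod.case insert_iff
      empty_iff fst_conv snd_conv prod.inject)
  apply blast
  done

text \<open>Symmetrising the digraph adds no condition, because the right-hand side already ranges
  over ordered pairs.\<close>

lemma independent_set_cayley_iff:
  "independent_set (with_proj (mk_symmetric (with_proj (cayley_digraph p A)))) S \<longleftrightarrow>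
     S \<subseteq> {0..<int p} \<and> (\<forall>u\<in>S. \<forall>v\<in>S. u \<noteq> v \<longrightarrow> (v - u) mod int p \<notin> A)"
  unfolding independent_set_def dominates_cayley_symmetric_iff verts_cayley_symmetric
proof (intro conj_cong refl iffI ballI impI)
  fix u v assume S: "S \<subseteq> {0..<int p}" "u \<in> S" "v \<in> S" "u \<noteq> v"
  {
    assume *: "\<forall>u\<in>S. \<forall>v\<in>S. u \<noteq> v \<longrightarrow> \<not> (u \<in> {0..<int p} \<and> v \<in> {0..<int p} \<and>
      ((v - u) mod int p \<in> A \<or> (u - v) mod int p \<in> A))"
    show "(v - u) mod int p \<notin> A"
      using *[rule_format, of u v] S(2,3,4) subsetD[OF S(1) S(2)] subsetD[OF S(1) S(3)] by simp
  next
    assume *: "\<forall>u\<in>S. \<forall>v\<in>S. u \<noteq> v \<longrightarrow> (v - u) mod int p \<notin> A"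
    show "\<not> (u \<in> {0..<int p} \<and> v \<in> {0..<int p} \<and>
      ((v - u) mod int p \<in> A \<or> (u - v) mod int p \<in> A))"
      using *[rule_format, of u v] *[rule_format, of v u] S(2,3,4) by simp
  }
qed

lemma finite_independent_sets_cayley:
  "finite {S. independent_set (with_proj (mk_symmetric (with_proj (cayley_digraph p A)))) S}"
  by (rule finite_subset[of _ "Pow {0..<int p}"]) (auto simp: independent_set_cayley_iff)

lemma card_le_independence_number_cayley:
  assumes "S \<subseteq> {0..<int p}"
    and "\<And>u v. u \<in> S \<Longrightarrow> v \<in> S \<Longrightarrow> u \<noteq> v \<Longrightarrow> (v - u) mod int p \<notin> A"
  shows "card S \<le> independence_number (with_proj (cayley_digraph p A))"
  unfolding independence_number_def
  using assms by (intro Max_ge finite_imageI imageI finite_independent_sets_cayley CollectI)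
    (auto simp: independent_set_cayley_iff)

lemma independence_number_cayley_le:
  assumes "\<And>S. S \<subseteq> {0..<int p} \<Longrightarrow>
      (\<And>u v. u \<in> S \<Longrightarrow> v \<in> S \<Longrightarrow> u \<noteq> v \<Longrightarrow> (v - u) mod int p \<notin> A) \<Longrightarrow> real (card S) \<le> b"
  shows "real (independence_number (with_proj (cayley_digraph p A))) \<le> b"
proof -
  let ?F = "{S. independent_set (with_proj (mk_symmetric (with_proj (cayley_digraph p A)))) S}"
  have "{} \<in> ?F"
    by (simp add: independent_set_cayley_iff)
  hence "Max (card ` ?F) \<in> card ` ?F"
    by (intro Max_in finite_imageI finite_independent_sets_cayley) blast
  then obtain S where "independence_number (with_proj (cayley_digraph p A)) = card S" "S \<in> ?F"
    unfolding independence_number_def by blast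
  thus ?thesis
    using assms[of S] by (simp add: independent_set_cayley_iff)
qed

text \<open>The maximum is attained, either by an admissible set or by the default value
  \<open>0\<close>; the latter is covered by \<open>0 \<le> b\<close>.\<close>

lemma max_solution_free_upper:
  assumes "\<And>A. A \<subseteq> {0..<int p} \<Longrightarrow> solution_free k c p A \<Longrightarrow>
      real (independence_number (with_proj (cayley_digraph p A))) \<le> \<epsilon> * real p \<Longrightarrow>
      real (card A) \<le> b"
    and "0 \<le> b"
  shows "real (max_solution_free k c \<epsilon> p) \<le> b"
proof -
  let ?X = "insert 0 (card ` {A. A \<subseteq> residue_set p \<and> solution_free k c p A \<and>
       real (independence_number (with_proj (cayley_digraph p A))) \<le> \<epsilon> * real p})"
  have fin: "finite (Pow (residue_set p))"
    by (simp add: residue_set_def)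
  have "finite ?X"
    by (intro finite.insertI finite_imageI) (rule finite_subset[OF _ fin], blast)
  hence "Max ?X \<in> ?X"
    by (rule Max_in) simp
  hence "max_solution_free k c \<epsilon> p \<in> ?X"
    unfolding max_solution_free_def .
  thus ?thesis
  proof (elim insertE imageE)
    fix A assume "max_solution_free k c \<epsilon> p = card A"
      and "A \<in> {A. A \<subseteq> residue_set p \<and> solution_free k c p A \<and>
       real (independence_number (with_proj (cayley_digraph p A))) \<le> \<epsilon> * real p}"
    thus ?thesis
      using assms(1)[of A] by (simp add: residue_set_def)
  qed (use assms(2) in simp)
qed

lemma max_solution_free_lower:
  assumes "A \<subseteq> {0..<int p}" "solution_free k c p A"
    and "real (independence_number (with_proj (cayley_digraph p A))) \<le> \<epsilon> * real p"
  shows "card A \<le> max_solution_free k c \<epsilon> p"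
proof -
  have fin: "finite (Pow (residue_set p))"
    by (simp add: residue_set_def)
  show ?thesis
    unfolding max_solution_free_def
    by (rule Max_ge, intro finite.insertI finite_imageI, rule finite_subset[OF _ fin])
      (use assms in \<open>auto simp: residue_set_def\<close>)
qed

lemma abs_sum_mult_le:
  fixes c e :: "'a \<Rightarrow> int"
  assumes "\<And>i. i \<in> S \<Longrightarrow> \<bar>e i\<bar> \<le> w"
  shows "\<bar>\<Sum>i\<in>S. c i * e i\<bar> \<le> (\<Sum>i\<in>S. \<bar>c i\<bar>) * w"
proof -
  have "\<bar>\<Sum>i\<in>S. c i * e i\<bar> \<le> (\<Sum>i\<in>S. \<bar>c i * e i\<bar>)"
    by (rule sum_abs)
  also have "\<dots> \<le> (\<Sum>i\<in>S. \<bar>c i\<bar> * w)"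
    by (intro sum_mono) (simp add: abs_mult assms mult_left_mono)
  finally show ?thesis
    by (simp add: sum_distrib_right)
qed

section \<open>Dense solution-free sets\<close>

text \<open>The contributions to the highest power of \<open>M\<close> add up to a sub-sum of the coefficients.\<close>

lemma lacunary_combination_nonzero:
  fixes c :: "'a \<Rightarrow> int" and j l :: "'a \<Rightarrow> nat" and M :: int
  assumes "finite S" "S \<noteq> {}"
    and sub: "\<And>T. T \<subseteq> S \<Longrightarrow> T \<noteq> {} \<Longrightarrow> (\<Sum>i\<in>T. c i) \<noteq> 0"
    and M: "(\<Sum>i\<in>S. \<bar>c i\<bar>) < M"
    and lj: "\<And>i. i \<in> S \<Longrightarrow> l i < j i"
  shows "(\<Sum>i\<in>S. c i * (M ^ j i - M ^ l i)) \<noteq> 0"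
proof -
  define v where "v = Max (j ` S)"
  define T where "T = {i\<in>S. j i = v}"
  have M1: "M \<ge> 1"
    using M sum_nonneg[of S "\<lambda>i. \<bar>c i\<bar>"] by (smt (verit) abs_ge_zero)
  have "v \<in> j ` S"
    unfolding v_def using assms by (intro Max_in) auto
  hence T: "T \<subseteq> S" "T \<noteq> {}"
    by (auto simp: T_def)
  have jv: "j i \<le> v" if "i \<in> S" for i
    unfolding v_def using that assms by (intro Max_ge) auto
  have v: "v \<ge> 1"
    using T lj by (fastforce simp: T_def)
  \<comment> \<open>What is left of each term once \<open>M ^ v\<close> has been split off for the
    indices in \<open>T\<close>; all remainders are at most \<open>M ^ (v - 1)\<close> in absolute
    value, so together they stay below \<open>M ^ v\<close>.\<close>
  define e where "e i = (if i \<in> T then - (M ^ l i) else M ^ j i - M ^ l i)" for i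
  have e: "\<bar>e i\<bar> \<le> M ^ (v - 1)" if i: "i \<in> S" for i
  proof (cases "i \<in> T")
    case True
    hence "l i \<le> v - 1"
      using lj[OF i] by (auto simp: T_def)
    thus ?thesis
      using True M1 by (simp add: e_def power_increasing)
  next
    case False
    hence "j i \<le> v - 1"
      using jv[OF i] i by (auto simp: T_def)
    moreover have "M ^ l i \<le> M ^ j i"
      using lj[OF i] M1 by (intro power_increasing) auto
    ultimately show ?thesis
      using False M1 power_increasing[OF \<open>j i \<le> v - 1\<close> M1] zero_le_power[of M "l i"]
      unfolding e_def by (simp only: if_False) linarith
  qed
  have "(\<Sum>i\<in>S. c i * (M ^ j i - M ^ l i)) = (\<Sum>i\<in>S. (if i \<in> T then c i * M ^ v else 0) + c i * e i)"
    by (rule sum.cong) (auto simp: e_def T_def algebra_simps)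
  also have "\<dots> = M ^ v * (\<Sum>i\<in>T. c i) + (\<Sum>i\<in>S. c i * e i)"
    using T \<open>finite S\<close> by (simp add: sum.distrib sum.If_cases Int_absorb1 sum_distrib_right mult.commute[of "M ^ v"])
  finally have eq: "(\<Sum>i\<in>S. c i * (M ^ j i - M ^ l i)) = M ^ v * (\<Sum>i\<in>T. c i) + (\<Sum>i\<in>S. c i * e i)" .
  have "\<bar>\<Sum>i\<in>S. c i * e i\<bar> \<le> (\<Sum>i\<in>S. \<bar>c i\<bar>) * M ^ (v - 1)"
    using e by (rule abs_sum_mult_le)
  also have "\<dots> < M * M ^ (v - 1)"
    using M M1 by (intro mult_strict_right_mono) auto
  also have "\<dots> = M ^ v"
    using v by (cases v) auto
  also have "\<dots> \<le> \<bar>M ^ v * (\<Sum>i\<in>T. c i)\<bar>"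
    using sub[OF T] M1 by (simp add: abs_mult)
  finally show ?thesis
    unfolding eq by linarith
qed

text \<open>
  The differences \<open>M ^ j - M ^ i\<close> alone bound the independence number, since two of the \<open>N + 1\<close>
  translates of a large set by \<open>M ^ i\<close> meet; the interval alone supplies the positive density.
\<close>

definition dense_free_set :: "int \<Rightarrow> nat \<Rightarrow> int \<Rightarrow> int \<Rightarrow> int set" where
  "dense_free_set M N q w = {M ^ j - M ^ i | i j. i < j \<and> j \<le> N} \<union> {q..q + w}"

text \<open>The bounds give \<open>C * (q + w) < p\<close>, so the congruence modulo
  \<open>p\<close> is an equality of integers. If elements of the interval occur, a non-zero
  multiple of \<open>q\<close> faces remainders of total size at most \<open>C * w < q\<close>;
  otherwise the lacunary lemma applies.\<close>

lemma solution_free_dense_free_set: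
  fixes c :: "nat \<Rightarrow> int" and C :: int
  assumes sub: "\<And>T. T \<subseteq> {1..k} \<Longrightarrow> T \<noteq> {} \<Longrightarrow> (\<Sum>i\<in>T. c i) \<noteq> 0"
    and k: "k \<ge> 1"
    and C: "C = (\<Sum>i\<in>{1..k}. \<bar>c i\<bar>)"
    and q: "2 * C * q \<le> int p" and w: "4 * C * w \<le> q" and N: "(C + 1) ^ N \<le> w"
  shows "solution_free k c p (dense_free_set (C + 1) N q w)"
  unfolding solution_free_def
proof
  let ?M = "C + 1" and ?S = "{1..k}"
  let ?R = "{?M ^ j - ?M ^ i | i j. i < j \<and> j \<le> N}"
  assume "\<exists>a. (\<forall>i\<in>?S. a i \<in> dense_free_set ?M N q w) \<and> inj_on a ?S \<and>
            [(\<Sum>i\<in>?S. c i * a i) = 0] (mod int p)"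
  then obtain a where "\<forall>i\<in>?S. a i \<in> dense_free_set ?M N q w"
    and cong: "[(\<Sum>i\<in>?S. c i * a i) = 0] (mod int p)"
    by blast
  hence a: "a i \<in> ?R \<union> {q..q + w}" if "i \<in> ?S" for i
    using that unfolding dense_free_set_def by blast
  have C0: "C \<ge> 1"
    using sub[of "{1}"] k member_le_sum[of 1 ?S "\<lambda>i. \<bar>c i\<bar>"] by (force simp: C)
  have w1: "w \<ge> 1"
    using N one_le_power[of ?M N] C0 by linarith
  have "4 * (1 * w) \<le> 4 * (C * w)"
    using C0 w1 by (intro mult_left_mono mult_right_mono) auto
  hence q4: "4 * w \<le> q"
    using w by (simp add: mult.assoc)
  have "2 * (1 * q) \<le> 2 * (C * q)"
    using C0 w1 q4 by (intro mult_left_mono mult_right_mono) auto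
  hence pq: "2 * q \<le> int p"
    using q by (simp add: mult.assoc)
  have R: "0 \<le> x \<and> x \<le> w" if "x \<in> ?R" for x
  proof -
    obtain i j where ij: "i < j" "j \<le> N" "x = ?M ^ j - ?M ^ i"
      using \<open>x \<in> ?R\<close> by blast
    have "?M ^ i \<le> ?M ^ j" "?M ^ j \<le> ?M ^ N" "?M ^ i \<ge> 0"
      using ij C0 by (auto intro!: power_increasing)
    thus ?thesis
      using ij N by linarith
  qed
  have "\<bar>\<Sum>i\<in>?S. c i * a i\<bar> \<le> C * (q + w)"
    unfolding C using a R w1 q4 by (intro abs_sum_mult_le) fastforce
  also have "\<dots> < int p"
    using q w pq q4 w1 by (simp add: algebra_simps)
  finally have zero: "(\<Sum>i\<in>?S. c i * a i) = 0"
    using cong by (metis cong_0_iff dvd_imp_le_int abs_of_nat not_le)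
  define T where "T = {i\<in>?S. a i \<in> {q..q + w}}"
  show False
  proof (cases "T = {}")
    case True
    hence "\<forall>i\<in>?S. \<exists>l j. l < j \<and> a i = ?M ^ j - ?M ^ l"
      using a by (fastforce simp: T_def)
    then obtain l j where lj: "\<And>i. i \<in> ?S \<Longrightarrow> l i < j i \<and> a i = ?M ^ j i - ?M ^ l i"
      by metis
    have "(\<Sum>i\<in>?S. c i * (?M ^ j i - ?M ^ l i)) \<noteq> 0"
      using sub k lj C by (intro lacunary_combination_nonzero) auto
    also have "(\<Sum>i\<in>?S. c i * (?M ^ j i - ?M ^ l i)) = (\<Sum>i\<in>?S. c i * a i)"
      using lj by (intro sum.cong) auto
    finally show False
      using zero by simp
  next
    case False
    have TS: "T \<subseteq> ?S"
      by (auto simp: T_def)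
    \<comment> \<open>Elements of the interval are measured from \<open>q\<close>, the others from
      \<open>0\<close>; either way the deviation is at most \<open>w\<close>.\<close>
    define e where "e i = (if i \<in> T then a i - q else a i)" for i
    have e: "\<bar>e i\<bar> \<le> w" if "i \<in> ?S" for i
    proof (cases "i \<in> T")
      case False
      hence "a i \<in> ?R"
        using a[OF that] that by (auto simp: T_def)
      thus ?thesis
        using R[of "a i"] False by (simp add: e_def)
    qed (auto simp: e_def T_def)
    have "(\<Sum>i\<in>?S. c i * a i) = (\<Sum>i\<in>?S. (if i \<in> T then c i * q else 0) + c i * e i)"
      by (rule sum.cong) (auto simp: e_def algebra_simps)
    also have "\<dots> = q * (\<Sum>i\<in>T. c i) + (\<Sum>i\<in>?S. c i * e i)"
      using Int_absorb1[OF TS] by (simp add: sum.distrib sum.If_cases sum_distrib_left mult.commute)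
    finally have eq: "q * (\<Sum>i\<in>T. c i) + (\<Sum>i\<in>?S. c i * e i) = 0"
      using zero by simp
    have "\<bar>\<Sum>i\<in>?S. c i * e i\<bar> \<le> C * w"
      unfolding C using e by (rule abs_sum_mult_le)
    also have "\<dots> < q"
      using w q4 w1 by simp
    also have "\<dots> \<le> \<bar>q * (\<Sum>i\<in>T. c i)\<bar>"
      using sub[OF TS False] q4 w1 by (simp add: abs_mult)
    finally show False
      using eq by linarith
  qed
qed

lemma independence_number_dense_free_set:
  fixes M :: int
  assumes M: "M \<ge> 2" "M ^ N < int p"
  shows "real (independence_number (with_proj (cayley_digraph p (dense_free_set M N q w))))
    \<le> real p / (N + 1)"
proof (rule independence_number_cayley_le)
  fix S assume S: "S \<subseteq> {0..<int p}"
    and ind: "\<And>u v. u \<in> S \<Longrightarrow> v \<in> S \<Longrightarrow> u \<noteq> v \<Longrightarrow> (v - u) mod int p \<notin> dense_free_set M N q w"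
  let ?f = "\<lambda>(i, s). (s + M ^ i) mod int p"
  have p0: "p > 0"
    using M zero_le_power[of M N] by linarith
  \<comment> \<open>Two translates of \<open>S\<close> cannot meet: \<open>M ^ i' - M ^ i\<close>
    would be the residue of \<open>s - s'\<close>, and it is its own residue since
    \<open>M ^ N < p\<close>. Hence the \<open>N + 1\<close> translates are disjoint and
    \<open>(N + 1) * card S \<le> p\<close>.\<close>
  have coll: False
    if "i < i'" "i' \<le> N" "s \<in> S" "s' \<in> S" "(s + M ^ i) mod int p = (s' + M ^ i') mod int p" for i i' s s'
  proof -
    have "[s + M ^ i = s' + M ^ i'] (mod int p)"
      using that by (simp add: cong_def)
    hence "[s - s' = M ^ i' - M ^ i] (mod int p)"
      by (auto simp: cong_iff_dvd_diff algebra_simps)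
    have "M ^ i < M ^ i'" "M ^ i' \<le> M ^ N" "M ^ i > 0"
      using M that by (auto intro!: power_strict_increasing power_increasing)
    hence "(M ^ i' - M ^ i) mod int p = M ^ i' - M ^ i"
      using M by (intro mod_pos_pos_trivial) linarith+
    with \<open>[s - s' = M ^ i' - M ^ i] (mod int p)\<close> have eq: "(s - s') mod int p = M ^ i' - M ^ i"
      by (simp add: cong_def)
    hence "(s - s') mod int p \<in> dense_free_set M N q w"
      using that by (auto simp: dense_free_set_def)
    moreover have "s \<noteq> s'"
      using eq \<open>M ^ i < M ^ i'\<close> by auto
    ultimately show False
      using ind[of s' s] that by auto
  qed
  have "inj_on ?f ({0..N} \<times> S)"
  proof (rule inj_onI)
    fix x y assume x: "x \<in> {0..N} \<times> S" and y: "y \<in> {0..N} \<times> S" and xy: "?f x = ?f y"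
    obtain i s i' s' where [simp]: "x = (i, s)" "y = (i', s')"
      by (cases x, cases y)
    have "i = i'"
      using coll[of i i' s s'] coll[of i' i s' s] x y xy by (cases i i' rule: linorder_cases) auto
    moreover from this have "[s = s'] (mod int p)"
      using xy by (simp add: cong_iff_dvd_diff mod_eq_dvd_iff)
    hence "s = s'"
      using S x y by (auto simp: cong_def subset_eq)
    ultimately show "x = y"
      by simp
  qed
  moreover have "?f ` ({0..N} \<times> S) \<subseteq> {0..<int p}"
    using p0 by auto
  ultimately have "card ({0..N} \<times> S) \<le> card {0..<int p}"
    by (rule card_inj_on_le) auto
  hence "(N + 1) * card S \<le> p"
    by (simp add: card_cartesian_product)
  hence "real (N + 1) * real (card S) \<le> real p"
    by (metis of_nat_le_iff of_nat_mult)
  thus "real (card S) \<le> real p / (N + 1)"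
    by (simp add: field_simps)
qed

text \<open>This is the infinitude of the primes; it lets an eventual lower bound pass to the
  \<open>Limsup\<close>.\<close>

lemma prime_filter_neq_bot:
  "inf sequentially (principal {p::nat. prime p}) \<noteq> bot"
proof -
  have "frequently (\<lambda>p::nat. prime p) sequentially"
    using primes_infinite by (simp add: frequently_cofinite cofinite_eq_sequentially[symmetric])
  thus ?thesis
    by (auto simp: trivial_limit_def eventually_inf_principal frequently_def)
qed

text \<open>The interval fills a proportion of about \<open>1 / (8 * C\<^sup>2)\<close> of the
  residues, whatever \<epsilon> is. Only the number of powers of \<open>C + 1\<close>, and with it
  the threshold for \<open>p\<close>, depends on \<epsilon>.\<close>

lemma solution_free_density_bounded_below:
  assumes sub: "\<And>T. T \<subseteq> {1..k} \<Longrightarrow> T \<noteq> {} \<Longrightarrow> (\<Sum>i\<in>T. c i) \<noteq> 0" and k: "k \<ge> 1"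
  shows "\<exists>\<delta>>0. \<forall>\<epsilon>>0. ereal \<delta> \<le> solution_free_density k c \<epsilon>"
proof -
  define C where "C = (\<Sum>i\<in>{1..k}. \<bar>c i\<bar>)"
  have C0: "C \<ge> 1"
    using sub[of "{1}"] k member_le_sum[of 1 "{1..k}" "\<lambda>i. \<bar>c i\<bar>"] by (force simp: C_def)
  define \<delta> where "\<delta> = 1 / (8 * (real_of_int C)\<^sup>2)"
  have "ereal \<delta> \<le> solution_free_density k c \<epsilon>" if \<epsilon>: "\<epsilon> > 0" for \<epsilon> :: real
  proof -
    obtain N :: nat where N: "1 / real (N + 1) < \<epsilon>"
      using reals_Archimedean[OF \<epsilon>] by (auto simp: inverse_eq_divide)
    \<comment> \<open>Large enough for \<open>(C + 1) ^ N \<le> w\<close>, where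
      \<open>w = p div (8 * C\<^sup>2)\<close>.\<close>
    define P :: int where "P = 8 * C\<^sup>2 * ((C + 1) ^ N + 1)"
    have "ereal \<delta> \<le> ereal (real (max_solution_free k c \<epsilon> p) / real p)" if p: "int p \<ge> P" for p
    proof -
      \<comment> \<open>\<open>q\<close> and then \<open>w\<close> are the largest integers with
        \<open>2 * C * q \<le> p\<close> and \<open>4 * C * w \<le> q\<close>.\<close>
      define q where "q = int p div (2 * C)"
      define w where "w = q div (4 * C)"
      have MN: "(C + 1) ^ N \<ge> 1"
        using C0 by (intro one_le_power) auto
      have w8: "w = int p div (8 * C\<^sup>2)"
        using C0 by (simp add: w_def q_def zdiv_zmult2_eq[symmetric] power2_eq_square algebra_simps)
      have "0 \<le> C\<^sup>2 * (C + 1) ^ N" "0 \<le> C\<^sup>2"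
        using C0 by simp_all
      moreover have "P = 8 * (C\<^sup>2 * (C + 1) ^ N) + 8 * C\<^sup>2"
        by (simp add: P_def algebra_simps)
      ultimately have "8 * C\<^sup>2 * (C + 1) ^ N \<le> int p"
        using p unfolding mult.assoc by linarith
      hence w1: "(C + 1) ^ N \<le> w"
        unfolding w8 using C0 zdiv_mono1[of "8 * C\<^sup>2 * ((C + 1) ^ N)" "int p" "8 * C\<^sup>2"] by simp
      have q2: "2 * C * q \<le> int p"
        unfolding q_def using C0 mult_div_mod_eq[of "2 * C" "int p"] pos_mod_sign[of "2 * C" "int p"]
        by linarith
      have w2: "4 * C * w \<le> q"
        unfolding w_def using C0 mult_div_mod_eq[of "4 * C" q] pos_mod_sign[of "4 * C" q]
        by linarith
      let ?A = "dense_free_set (C + 1) N q w"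
      have w0: "w \<ge> 1"
        using w1 MN by linarith
      have wq: "4 * w \<le> q"
        using w2 w0 mult_right_mono[OF C0, of w] unfolding mult.assoc by linarith
      have qp: "2 * q \<le> int p"
        using q2 w0 wq mult_right_mono[OF C0, of q] unfolding mult.assoc by linarith
      have "?A \<subseteq> {0..<int p}"
      proof
        fix x assume "x \<in> ?A"
        then consider "q \<le> x \<and> x \<le> q + w" | i j where "i < j" "j \<le> N" "x = (C + 1) ^ j - (C + 1) ^ i"
          by (auto simp: dense_free_set_def)
        thus "x \<in> {0..<int p}"
        proof cases
          case 1
          thus ?thesis using wq qp w0 by simp
        next
          case (2 i j)
          have "(C + 1) ^ i \<le> (C + 1) ^ j" "(C + 1) ^ j \<le> (C + 1) ^ N" "(C + 1) ^ i > 0"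
            using 2 C0 by (auto intro!: power_increasing)
          thus ?thesis using 2(3) wq qp w0 w1 by (simp only: atLeastLessThan_iff) linarith
        qed
      qed
      moreover have "solution_free k c p ?A"
        using sub k C_def q2 w2 w1 by (rule solution_free_dense_free_set)
      moreover have "(C + 1) ^ N < int p"
        using w1 wq qp w0 by linarith
      hence "real (independence_number (with_proj (cayley_digraph p ?A))) \<le> real p / (N + 1)"
        using C0 by (intro independence_number_dense_free_set) auto
      moreover have "real p / (N + 1) \<le> \<epsilon> * real p"
        using mult_right_mono[OF less_imp_le[OF N], of "real p"] by simp
      ultimately have "card ?A \<le> max_solution_free k c \<epsilon> p"
        by (intro max_solution_free_lower) auto
      moreover have "card {q..q + w} \<le> card ?A"
        using finite_subset[OF \<open>?A \<subseteq> {0..<int p}\<close>] by (intro card_mono) (auto simp: dense_free_set_def)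
      moreover have "int (card {q..q + w}) = w + 1"
        using w1 MN by simp
      ultimately have "w + 1 \<le> int (max_solution_free k c \<epsilon> p)"
        by linarith
      hence "8 * C\<^sup>2 * (w + 1) \<le> 8 * C\<^sup>2 * int (max_solution_free k c \<epsilon> p)"
        by (intro mult_left_mono) auto
      moreover have "0 < 8 * C\<^sup>2"
        using C0 by simp
      hence "int p < 8 * C\<^sup>2 * (w + 1)"
        unfolding w8 distrib_left using mult_div_mod_eq[of "8 * C\<^sup>2" "int p"]
          pos_mod_bound[of "8 * C\<^sup>2" "int p"] by linarith
      ultimately have "int p \<le> 8 * C\<^sup>2 * int (max_solution_free k c \<epsilon> p)"
        by linarith
      hence "real_of_int (int p) \<le> real_of_int (8 * C\<^sup>2 * int (max_solution_free k c \<epsilon> p))"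
        by (simp only: of_int_le_iff)
      hence "real p \<le> 8 * (real_of_int C)\<^sup>2 * real (max_solution_free k c \<epsilon> p)"
        by simp
      moreover have "p > 0" "(real_of_int C)\<^sup>2 > 0"
        using C0 qp wq w0 by (auto intro!: gr0I)
      ultimately show ?thesis
        by (simp add: \<delta>_def field_simps)
    qed
    hence "eventually (\<lambda>p. ereal \<delta> \<le> ereal (real (max_solution_free k c \<epsilon> p) / real p))
        (inf sequentially (principal {p. prime p}))"
      unfolding eventually_inf_principal
      using eventually_ge_at_top[of "nat P"] by (auto elim!: eventually_mono simp: nat_le_iff)
    thus ?thesis
      unfolding solution_free_density_def by (intro le_Limsup prime_filter_neq_bot)
  qed
  moreover have "\<delta> > 0"
    using C0 by (simp add: \<delta>_def)
  ultimately show ?thesis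
    by blast
qed

section \<open>Translation-invariant equations in dense sets of integers\<close>

text \<open>At most half of the guaranteed \<open>\<gamma> * N\<close> points are followed by a gap
  longer than \<open>T\<close>. Every other point has a later one at distance
  \<open>q \<le> T\<close>, and the pigeonhole principle selects one \<open>q\<close> for a fixed
  proportion of them.\<close>

lemma many_recurrent_points:
  fixes \<gamma> :: real
  assumes "\<gamma> > 0"
  obtains T N0 :: nat and \<gamma>' :: real where "\<gamma>' > 0"
    "\<And>N a D. N \<ge> N0 \<Longrightarrow> D \<subseteq> {a..<a + int N} \<Longrightarrow> \<gamma> * real N \<le> real (card D) \<Longrightarrow>
      \<exists>q. 1 \<le> q \<and> q \<le> int T \<and> \<gamma>' * real N \<le> real (card {x\<in>D. x + q \<in> D})"
proof -
  define T where "T = nat \<lceil>4 / \<gamma>\<rceil>"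
  have T: "real T \<ge> 4 / \<gamma>"
    unfolding T_def by linarith
  hence T0: "T > 0"
    using assms by (auto intro!: gr0I simp: divide_le_0_iff)
  have rec: "\<exists>q. 1 \<le> q \<and> q \<le> int T \<and> \<gamma> / (2 * T) * real N \<le> real (card {x\<in>D. x + q \<in> D})"
    if N: "N \<ge> T" and D: "D \<subseteq> {a..<a + int N}" and cD: "\<gamma> * real N \<le> real (card D)"
    for N a D
  proof (rule ccontr)
    assume no: "\<not> ?thesis"
    have fin: "finite D"
      using D finite_subset by blast
    \<comment> \<open>The points followed by a long gap. Each block of \<open>T\<close> consecutive
      integers contains at most one of them, so there are at most \<open>N / T + 1\<close>.\<close>
    define G where "G = {x\<in>D. \<forall>y\<in>D. \<not> (x < y \<and> y \<le> x + int T)}"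
    have "inj_on (\<lambda>x. (x - a) div int T) G"
    proof (rule inj_onI)
      fix x y assume xy: "x \<in> G" "y \<in> G" "(x - a) div int T = (y - a) div int T"
      have "\<bar>x - y\<bar> < int T"
        using T0 div_mult_mod_eq[of "x - a" "int T"] div_mult_mod_eq[of "y - a" "int T"]
          pos_mod_bound[of "int T" "x - a"] pos_mod_bound[of "int T" "y - a"]
          pos_mod_sign[of "int T" "x - a"] pos_mod_sign[of "int T" "y - a"]
        unfolding xy(3) by linarith
      thus "x = y"
        using xy(1,2) by (cases x y rule: linorder_cases) (auto simp: G_def)
    qed
    moreover have "(\<lambda>x. (x - a) div int T) ` G \<subseteq> {0..int (N div T)}"
      using D T0 by (auto simp: G_def zdiv_int pos_imp_zdiv_nonneg_iff subset_eq intro!: zdiv_mono1)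
    ultimately have "card G \<le> card {0..int (N div T)}"
      by (intro card_inj_on_le) auto
    hence "real (card G) \<le> real (N div T) + 1"
      by simp
    also have "real (N div T) \<le> real N / real T"
      by (rule of_nat_div_le_of_nat)
    also have "real N / real T \<le> real N / (4 / \<gamma>)"
      using T assms T0 by (intro divide_left_mono) auto
    finally have G: "real (card G) \<le> \<gamma> * real N / 4 + 1"
      by (simp add: mult.commute)
    have "4 / \<gamma> \<le> real N"
      using T N by linarith
    hence "1 \<le> \<gamma> * real N / 4"
      using assms by (simp add: field_simps)
    hence G2: "real (card G) \<le> \<gamma> * real N / 2"
      using G by linarith
    have "D - G \<subseteq> (\<Union>q\<in>{1..int T}. {x\<in>D. x + q \<in> D})"
    proof
      fix x assume "x \<in> D - G"
      then obtain y where y: "x \<in> D" "y \<in> D" "x < y" "y \<le> x + int T"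
        by (auto simp: G_def)
      thus "x \<in> (\<Union>q\<in>{1..int T}. {x\<in>D. x + q \<in> D})"
        by (intro UN_I[of "y - x"]) auto
    qed
    hence "card (D - G) \<le> card (\<Union>q\<in>{1..int T}. {x\<in>D. x + q \<in> D})"
      using fin by (intro card_mono) auto
    also have "\<dots> \<le> (\<Sum>q\<in>{1..int T}. card {x\<in>D. x + q \<in> D})"
      by (rule card_UN_le) simp
    finally have "real (card (D - G)) \<le> (\<Sum>q\<in>{1..int T}. real (card {x\<in>D. x + q \<in> D}))"
      by (simp flip: of_nat_sum)
    also have "\<dots> < (\<Sum>q\<in>{1..int T}. \<gamma> / (2 * T) * real N)"
      using no T0 by (intro sum_strict_mono) auto
    also have "\<dots> = \<gamma> * real N / 2"
      using T0 by simp
    finally have "real (card (D - G)) < \<gamma> * real N / 2" .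
    moreover have "card D = card (D - G) + card G"
      using card_Diff_subset[of G D] card_mono[of D G] fin finite_subset[of G D]
      by (auto simp: G_def)
    ultimately show False
      using G2 cD by simp
  qed
  have "\<gamma> / (2 * T) > 0"
    using assms T0 by simp
  thus thesis
    using rec by (rule that)
qed

text \<open>Hilbert's cube lemma, by induction on the dimension: the points \<open>x\<close> with
  \<open>x\<close> and \<open>x + q'\<close> both in \<open>D\<close> are still dense, and a cube
  among them extends by the difference \<open>q'\<close>. The bound \<open>T\<close> on the
  differences does not grow with \<open>N\<close>, which keeps boundary effects small later.\<close>

lemma hilbert_cube:
  fixes \<gamma> :: real and d :: nat
  assumes "\<gamma> > 0"
  shows "\<exists>T N0 :: nat. \<forall>N a D. N \<ge> N0 \<longrightarrow> D \<subseteq> {a..<a + int N} \<longrightarrow> \<gamma> * real N \<le> real (card D) \<longrightarrow>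
    (\<exists>b q. (\<forall>i<d. 1 \<le> q i \<and> q i \<le> int T) \<and> (\<forall>J\<subseteq>{..<d}. b + (\<Sum>j\<in>J. q j) \<in> D))"
  using assms
proof (induction d arbitrary: \<gamma>)
  case 0
  have "\<exists>b. b \<in> D" if "N \<ge> 1" "\<gamma> * real N \<le> real (card D)" for N :: nat and D :: "int set"
  proof -
    have "0 < \<gamma> * real N"
      using that \<open>\<gamma> > 0\<close> by simp
    thus ?thesis
      using that by (cases "D = {}") auto
  qed
  note nonempty = this
  show ?case
  proof (rule exI[of _ "0::nat"], rule exI[of _ "1::nat"], intro allI impI)
    fix N :: nat and a :: int and D :: "int set" assume "1 \<le> N" "\<gamma> * real N \<le> real (card D)"
    then obtain b where "b \<in> D"
      using nonempty by blast
    thus "\<exists>b q. (\<forall>i<0::nat. 1 \<le> q i \<and> q i \<le> int 0) \<and> (\<forall>J\<subseteq>{..<0}. b + (\<Sum>j\<in>J. q j) \<in> D)"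
      by (intro exI[of _ b] exI[of _ "\<lambda>_. 0"]) simp
  qed
next
  case (Suc d)
  obtain T1 N1 :: nat and \<gamma>' :: real where \<gamma>': "\<gamma>' > 0"
    and rec: "\<And>N a D. N \<ge> N1 \<Longrightarrow> D \<subseteq> {a..<a + int N} \<Longrightarrow> \<gamma> * real N \<le> real (card D) \<Longrightarrow>
      \<exists>q. 1 \<le> q \<and> q \<le> int T1 \<and> \<gamma>' * real N \<le> real (card {x\<in>D. x + q \<in> D})"
    by (rule many_recurrent_points[OF Suc.prems]) (rule that)
  obtain T2 N2 :: nat where IH: "\<forall>N a D. N \<ge> N2 \<longrightarrow> D \<subseteq> {a..<a + int N} \<longrightarrow>
      \<gamma>' * real N \<le> real (card D) \<longrightarrow>
      (\<exists>b q. (\<forall>i<d. 1 \<le> q i \<and> q i \<le> int T2) \<and> (\<forall>J\<subseteq>{..<d}. b + (\<Sum>j\<in>J. q j) \<in> D))"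
    using Suc.IH[OF \<gamma>'] by (elim exE) (rule that)
  show ?case
  proof (rule exI[of _ "max T1 T2"], rule exI[of _ "max N1 N2"], intro allI impI)
    fix N a D
    assume N: "max N1 N2 \<le> N" and D: "D \<subseteq> {a..<a + int N}" and cD: "\<gamma> * real N \<le> real (card D)"
    obtain q' where q': "1 \<le> q'" "q' \<le> int T1" "\<gamma>' * real N \<le> real (card {x\<in>D. x + q' \<in> D})"
      using rec[OF _ D cD] N by auto
    obtain b q where q: "\<And>i. i < d \<Longrightarrow> 1 \<le> q i \<and> q i \<le> int T2"
      and b: "\<And>J. J \<subseteq> {..<d} \<Longrightarrow> b + (\<Sum>j\<in>J. q j) \<in> {x\<in>D. x + q' \<in> D}"
      using IH[rule_format, OF _ _ q'(3), of a] N D by auto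
    have "b + (\<Sum>j\<in>J. (q(d := q')) j) \<in> D" if J: "J \<subseteq> {..<Suc d}" for J
    proof -
      have J': "J - {d} \<subseteq> {..<d}"
        using J by (auto simp: less_Suc_eq)
      have fin: "finite J"
        using J finite_subset by blast
      have eq: "(\<Sum>j\<in>J - {d}. (q(d := q')) j) = (\<Sum>j\<in>J - {d}. q j)"
        by (rule sum.cong) auto
      show ?thesis
      proof (cases "d \<in> J")
        case True
        hence "(\<Sum>j\<in>J. (q(d := q')) j) = q' + (\<Sum>j\<in>J - {d}. q j)"
          using fin eq by (simp add: sum.remove del: fun_upd_apply) simp
        thus ?thesis
          using b[OF J'] by (simp add: algebra_simps)
      next
        case False
        thus ?thesis
          using b[OF J'] eq by simp
      qed
    qed
    moreover have "1 \<le> (q(d := q')) i \<and> (q(d := q')) i \<le> int (max T1 T2)" if "i < Suc d" for i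
      using q[of i] q' that by (auto simp: less_Suc_eq)
    ultimately show "\<exists>b q. (\<forall>i<Suc d. 1 \<le> q i \<and> q i \<le> int (max T1 T2)) \<and>
        (\<forall>J\<subseteq>{..<Suc d}. b + (\<Sum>j\<in>J. q j) \<in> D)"
      by (intro exI[of _ b] exI[of _ "q(d := q')"] conjI allI impI) simp_all
  qed
qed

text \<open>Both sides equal \<open>card Y\<close> minus the number of pairs \<open>y\<close>,
  \<open>y + Q\<close> inside \<open>Y\<close>.\<close>

lemma card_exit_uminus:
  fixes Y :: "int set"
  assumes "finite Y"
  shows "card {y\<in>Y. y + Q \<notin> Y} = card {y\<in>Y. y - Q \<notin> Y}"
proof -
  have "bij_betw (\<lambda>y. y + Q) {y\<in>Y. y + Q \<in> Y} {y\<in>Y. y - Q \<in> Y}"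
    by (rule bij_betw_byWitness[where f' = "\<lambda>y. y - Q"]) auto
  hence "card {y\<in>Y. y + Q \<in> Y} = card {y\<in>Y. y - Q \<in> Y}"
    by (rule bij_betw_same_card)
  moreover have "card Y = card {y\<in>Y. y + Q \<in> Y} + card {y\<in>Y. y + Q \<notin> Y}"
    using assms by (subst card_Un_disjoint[symmetric]) (auto intro: arg_cong[where f = card])
  moreover have "card Y = card {y\<in>Y. y - Q \<in> Y} + card {y\<in>Y. y - Q \<notin> Y}"
    using assms by (subst card_Un_disjoint[symmetric]) (auto intro: arg_cong[where f = card])
  ultimately show ?thesis
    by simp
qed

section \<open>The extremal density of sets free of a translation-invariant equation\<close>

definition eqn_free :: "'a set \<Rightarrow> ('a \<Rightarrow> int) \<Rightarrow> int set \<Rightarrow> bool" where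
  "eqn_free S c A \<longleftrightarrow> \<not> (\<exists>x. x ` S \<subseteq> A \<and> inj_on x S \<and> (\<Sum>s\<in>S. c s * x s) = 0)"

lemma eqn_free_subset: "eqn_free S c A \<Longrightarrow> B \<subseteq> A \<Longrightarrow> eqn_free S c B"
  by (auto simp: eqn_free_def)

text \<open>With two variables of opposite coefficients the equation would say that they are equal,
  and every set would be free of solutions in distinct elements; hence
  \<open>card S \<ge> 3\<close>.\<close>

locale invariant_equation =
  fixes S :: "'a set" and c :: "'a \<Rightarrow> int"
  assumes finite_S: "finite S" and card_S: "card S \<ge> 3"
    and nonzero: "\<And>s. s \<in> S \<Longrightarrow> c s \<noteq> 0" and sum_c: "(\<Sum>s\<in>S. c s) = 0"
begin

definition max_free :: "nat \<Rightarrow> nat" where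
  "max_free n = Max (card ` {A. A \<subseteq> {0..<int n} \<and> eqn_free S c A})"

lemma S_nonempty: "S \<noteq> {}"
  using card_S by auto

lemma eqn_free_empty: "eqn_free S c {}"
  using S_nonempty by (auto simp: eqn_free_def)

lemma card_le_max_free: "A \<subseteq> {0..<int n} \<Longrightarrow> eqn_free S c A \<Longrightarrow> card A \<le> max_free n"
  unfolding max_free_def by (intro Max_ge) auto

lemma max_free_attained:
  obtains A where "A \<subseteq> {0..<int n}" "eqn_free S c A" "card A = max_free n"
proof -
  have "max_free n \<in> card ` {A. A \<subseteq> {0..<int n} \<and> eqn_free S c A}"
    unfolding max_free_def using eqn_free_empty by (intro Max_in) auto
  thus thesis
    using that by auto
qed

lemma max_free_le: "max_free n \<le> n"
proof -
  obtain A where "A \<subseteq> {0..<int n}" "eqn_free S c A" "card A = max_free n"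
    by (rule max_free_attained)
  thus ?thesis
    using card_mono[of "{0..<int n}" A] by simp
qed

text \<open>Because \<open>c\<close> sums to \<open>0\<close>, substituting
  \<open>y + Q * x s\<close> for \<open>x s\<close> merely multiplies the left-hand side by
  \<open>Q\<close>. So the bound for initial intervals extends to all arithmetic
  progressions.\<close>

lemma eqn_free_affine:
  assumes "eqn_free S c A" "Q \<noteq> 0"
  shows "eqn_free S c {j. y + Q * j \<in> A}"
  unfolding eqn_free_def
proof
  assume "\<exists>x. x ` S \<subseteq> {j. y + Q * j \<in> A} \<and> inj_on x S \<and> (\<Sum>s\<in>S. c s * x s) = 0"
  then obtain x where x: "x ` S \<subseteq> {j. y + Q * j \<in> A}" "inj_on x S" "(\<Sum>s\<in>S. c s * x s) = 0"
    by blast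
  have "(\<Sum>s\<in>S. c s * (y + Q * x s)) = y * (\<Sum>s\<in>S. c s) + Q * (\<Sum>s\<in>S. c s * x s)"
    by (simp add: sum_distrib_left sum.distrib[symmetric] algebra_simps)
  hence "(\<Sum>s\<in>S. c s * (y + Q * x s)) = 0"
    using x sum_c by simp
  moreover have "inj_on (\<lambda>s. y + Q * x s) S"
    using x(2) assms(2) by (auto simp: inj_on_def)
  moreover have "(\<lambda>s. y + Q * x s) ` S \<subseteq> A"
    using x(1) by auto
  ultimately show False
    using assms(1) unfolding eqn_free_def by blast
qed

lemma card_progression_le:
  assumes "eqn_free S c A" "Q \<noteq> 0"
  shows "card (A \<inter> (\<lambda>j. y + Q * j) ` {0..<int n}) \<le> max_free n"
proof -
  let ?B = "{j. y + Q * j \<in> A} \<inter> {0..<int n}"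
  have "A \<inter> (\<lambda>j. y + Q * j) ` {0..<int n} = (\<lambda>j. y + Q * j) ` ?B"
    by auto
  also have "card \<dots> \<le> card ?B"
    by (intro card_image_le) auto
  also have "\<dots> \<le> max_free n"
    using eqn_free_affine[OF assms] by (intro card_le_max_free) (auto intro: eqn_free_subset)
  finally show ?thesis .
qed

lemma card_interval_le:
  assumes "eqn_free S c A"
  shows "card (A \<inter> {a..<a + int n}) \<le> max_free n"
proof -
  have "{a..<a + int n} = (\<lambda>j. a + 1 * j) ` {0..<int n}"
    by auto
  thus ?thesis
    using card_progression_le[OF assms, of 1 a n] by simp
qed

lemma max_free_add: "max_free (m + n) \<le> max_free m + max_free n"
proof -
  obtain A where A: "A \<subseteq> {0..<int (m + n)}" "eqn_free S c A" "card A = max_free (m + n)"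
    by (rule max_free_attained)
  have "A = (A \<inter> {0..<0 + int m}) \<union> (A \<inter> {int m..<int m + int n})"
    using A(1) by auto
  hence "card A \<le> card (A \<inter> {0..<0 + int m}) + card (A \<inter> {int m..<int m + int n})"
    by (metis card_Un_le)
  thus ?thesis
    using card_interval_le[OF A(2), of 0 m] card_interval_le[OF A(2), of "int m" n] A(3) by linarith
qed

lemma max_free_mult: "max_free (m * l) \<le> m * max_free l"
proof (induction m)
  case 0
  show ?case using max_free_le[of 0] by simp
next
  case (Suc m)
  thus ?case using max_free_add[of l "m * l"] by simp
qed

text \<open>By subadditivity (Fekete) this infimum is also the limit.\<close>

definition limit_density :: real where
  "limit_density = Inf ((\<lambda>n. real (max_free n) / real n) ` {1..})"

lemma limit_density_le: "limit_density * real n \<le> real (max_free n)"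
proof (cases "n = 0")
  case False
  have "limit_density \<le> real (max_free n) / real n"
    unfolding limit_density_def using False
    by (intro cInf_lower bdd_belowI[of _ 0]) auto
  thus ?thesis
    using False by (simp add: field_simps)
qed simp

text \<open>Fekete's argument: choose a block length \<open>l\<close> whose ratio is within \<eta>
  of the infimum, cut \<open>n\<close> into blocks of that length, and pay at most \<open>l\<close>
  for the remainder. The additive constant serves all \<open>n\<close> at once.\<close>

lemma limit_density_approx:
  assumes "\<eta> > 0"
  obtains l :: real where "l \<ge> 0" "\<And>n. real (max_free n) \<le> (limit_density + \<eta>) * real n + l"
proof -
  have "\<exists>x\<in>(\<lambda>n. real (max_free n) / real n) ` {1..}. x < limit_density + \<eta>"
    unfolding limit_density_def using assms by (intro cInf_lessD) auto
  then obtain l where l: "l \<ge> 1" "real (max_free l) / real l < limit_density + \<eta>"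
    by auto
  have "real (max_free n) \<le> (limit_density + \<eta>) * real n + real l" for n
  proof -
    have "max_free n \<le> max_free (n div l * l) + max_free (n mod l)"
      using max_free_add[of "n div l * l" "n mod l"] by simp
    also have "\<dots> \<le> n div l * max_free l + l"
      using max_free_mult[of "n div l" l] max_free_le[of "n mod l"] mod_less_divisor[of l n] l(1)
      by linarith
    finally have "real (max_free n) \<le> real (n div l) * real (max_free l) + real l"
      by (metis of_nat_le_iff of_nat_add of_nat_mult)
    also have "real (n div l) * real (max_free l) \<le> real n / real l * real (max_free l)"
      by (intro mult_right_mono of_nat_div_le_of_nat) auto
    also have "\<dots> = real (max_free l) / real l * real n"
      by simp
    also have "\<dots> \<le> (limit_density + \<eta>) * real n"
      using l(2) by (intro mult_right_mono) auto
    finally show ?thesis by simp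
  qed
  thus thesis
    using that[of "real l"] by simp
qed

text \<open>
  A finite set splits into as many progressions with difference \<open>Q\<close> as it has elements \<open>y\<close>
  with \<open>y + Q\<close> outside.
\<close>

lemma card_le_by_runs_pos:
  fixes \<theta> l :: real
  assumes A: "eqn_free S c A" and "finite Y" and Q: "Q > 0"
    and bound: "\<And>n. real (max_free n) \<le> \<theta> * real n + l"
  shows "real (card (A \<inter> Y)) \<le> \<theta> * real (card Y) + l * real (card {y\<in>Y. y + Q \<notin> Y})"
  using \<open>finite Y\<close>
proof (induction "card Y" arbitrary: Y rule: less_induct)
  case less
  show ?case
  proof (cases "Y = {}")
    case False
    \<comment> \<open>Split off the maximal progression with difference \<open>Q\<close> that starts
      at the least element and apply the induction hypothesis to the rest.\<close>
    define y0 where "y0 = Min Y"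
    have y0: "y0 \<in> Y" "\<And>y. y \<in> Y \<Longrightarrow> y0 \<le> y"
      using False less.prems by (auto simp: y0_def)
    have "\<exists>n::nat. y0 + Q * int n \<notin> Y"
    proof (rule ccontr)
      assume "\<not> ?thesis"
      hence "range (\<lambda>n::nat. y0 + Q * int n) \<subseteq> Y"
        by auto
      moreover have "inj (\<lambda>n::nat. y0 + Q * int n)"
        using Q by (auto simp: inj_def)
      ultimately show False
        using less.prems finite_imageD finite_subset infinite_UNIV_nat by blast
    qed
    define n where "n = (LEAST n::nat. y0 + Q * int n \<notin> Y)"
    have n: "y0 + Q * int n \<notin> Y"
      unfolding n_def using \<open>\<exists>n::nat. y0 + Q * int n \<notin> Y\<close> by (rule LeastI_ex)
    have ltn: "y0 + Q * int m \<in> Y" if "m < n" for m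
      using not_less_Least[of m "\<lambda>n. y0 + Q * int n \<notin> Y"] that unfolding n_def by blast
    have n0: "n > 0"
      using n y0(1) by (cases n) auto
    define P where "P = (\<lambda>j. y0 + Q * j) ` {0..<int n}"
    have PY: "P \<subseteq> Y"
    proof
      fix y assume "y \<in> P"
      then obtain j where "0 \<le> j" "j < int n" "y = y0 + Q * j"
        by (auto simp: P_def)
      thus "y \<in> Y"
        using ltn[of "nat j"] by auto
    qed
    have cP: "card P = n"
      unfolding P_def using Q by (subst card_image) (auto simp: inj_on_def)
    have cY: "card Y = n + card (Y - P)"
      using PY cP less.prems card_mono[OF less.prems PY]
      by (simp add: card_Diff_subset finite_subset)
    \<comment> \<open>The end \<open>?z\<close> of the progression is an exit of \<open>Y\<close>,
      and every exit of the rest is one too: it could only step into the progression at its first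
      point, from below the minimum \<open>y0\<close>, or from the preceding point of the
      progression. Thus at least one exit is used up.\<close>
    let ?E = "{y\<in>Y - P. y + Q \<notin> Y - P}" and ?z = "y0 + Q * (int n - 1)"
    have zP: "?z \<in> P"
      using n0 by (auto simp: P_def)
    have "insert ?z ?E \<subseteq> {y\<in>Y. y + Q \<notin> Y}"
    proof -
      have "?z + Q = y0 + Q * int n"
        by (simp add: algebra_simps)
      hence "?z + Q \<notin> Y"
        using n by (simp only: simp_thms)
      moreover have "y + Q \<notin> Y" if "y \<in> ?E" for y
      proof
        assume "y + Q \<in> Y"
        hence "y + Q \<in> P" and y: "y \<in> Y" "y \<notin> P"
          using that by auto
        then obtain j where j: "0 \<le> j" "j < int n" "y + Q = y0 + Q * j"
          by (auto simp: P_def)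
        show False
        proof (cases "j = 0")
          case True
          thus False using j y0(2)[OF y(1)] Q by simp
        next
          case False
          hence "y = y0 + Q * (j - 1)" "j - 1 \<in> {0..<int n}"
            using j by (auto simp: algebra_simps)
          thus False using y(2) unfolding P_def by blast
        qed
      qed
      moreover have "?z \<in> Y"
        using zP PY by (rule subsetD[rotated])
      ultimately show ?thesis
        by blast
    qed
    moreover have "?z \<notin> ?E"
      using zP by blast
    ultimately have "card ?E + 1 \<le> card {y\<in>Y. y + Q \<notin> Y}"
      using card_mono[of "{y\<in>Y. y + Q \<notin> Y}" "insert ?z ?E"] less.prems by simp
    moreover have "l \<ge> 0"
      using order_trans[OF of_nat_0_le_iff bound[of 0]] by simp
    ultimately have E: "l * (real (card ?E) + 1) \<le> l * real (card {y\<in>Y. y + Q \<notin> Y})"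
      by (intro mult_left_mono) auto
    have "card (A \<inter> Y) = card ((A \<inter> P) \<union> (A \<inter> (Y - P)))"
      using PY by (intro arg_cong[where f = card]) auto
    also have "\<dots> \<le> card (A \<inter> P) + card (A \<inter> (Y - P))"
      by (rule card_Un_le)
    also have "card (A \<inter> P) \<le> max_free n"
      unfolding P_def using A Q by (intro card_progression_le) auto
    finally have "real (card (A \<inter> Y)) \<le> real (max_free n) + real (card (A \<inter> (Y - P)))"
      by linarith
    also have "real (card (A \<inter> (Y - P))) \<le> \<theta> * real (card (Y - P)) + l * real (card ?E)"
      using less.prems cY n0 by (intro less.hyps) auto
    finally show ?thesis
      using bound[of n] E cY by (simp add: algebra_simps)
  qed simp
qed

text \<open>For negative \<open>Q\<close> the progressions are traversed backwards, which does not
  alter the number of exits.\<close>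

lemma card_le_by_runs:
  fixes \<theta> l :: real
  assumes A: "eqn_free S c A" and "finite Y" and "Q \<noteq> 0"
    and bound: "\<And>n. real (max_free n) \<le> \<theta> * real n + l"
  shows "real (card (A \<inter> Y)) \<le> \<theta> * real (card Y) + l * real (card {y\<in>Y. y + Q \<notin> Y})"
proof (cases "Q > 0")
  case True
  show ?thesis
    by (rule card_le_by_runs_pos[OF A \<open>finite Y\<close> True bound])
next
  case False
  thus ?thesis
    using card_le_by_runs_pos[OF A \<open>finite Y\<close> _ bound, of "- Q"] \<open>Q \<noteq> 0\<close>
      card_exit_uminus[OF \<open>finite Y\<close>, of Q] by simp
qed

end

section \<open>The cube argument\<close>

context invariant_equation
begin

definition norm_c :: int where
  "norm_c = (\<Sum>s\<in>S. \<bar>c s\<bar>)"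

lemma abs_c_le: "s \<in> S \<Longrightarrow> \<bar>c s\<bar> \<le> norm_c"
  unfolding norm_c_def by (rule member_le_sum) (auto simp: finite_S)

lemma norm_c_ge_1: "norm_c \<ge> 1"
proof -
  obtain s where "s \<in> S"
    using S_nonempty by blast
  thus ?thesis
    using abs_c_le[of s] nonzero[of s] by linarith
qed

text \<open>If every other coefficient were \<open>- c s3\<close>, the sum would be
  \<open>(2 - card S) * c s3\<close>, which is non-zero. The condition
  \<open>c s1 + c s3 \<noteq> 0\<close> limits the degenerate solutions with
  \<open>x s1 = x s3\<close>.\<close>

lemma distinct_triple:
  obtains s1 s2 s3 where "s1 \<in> S" "s2 \<in> S" "s3 \<in> S" "s1 \<noteq> s2" "s1 \<noteq> s3" "s2 \<noteq> s3"
    "c s1 + c s3 \<noteq> 0"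
proof -
  obtain s3 where s3: "s3 \<in> S"
    using S_nonempty by blast
  have "\<exists>s1\<in>S - {s3}. c s1 + c s3 \<noteq> 0"
  proof (rule ccontr)
    assume "\<not> ?thesis"
    hence "(\<Sum>s\<in>S - {s3}. c s) = (\<Sum>s\<in>S - {s3}. - c s3)"
      by (intro sum.cong) (auto simp: add_eq_0_iff)
    moreover have "(\<Sum>s\<in>S. c s) = c s3 + (\<Sum>s\<in>S - {s3}. c s)"
      using finite_S s3 by (simp add: sum.remove)
    ultimately have "c s3 = (int (card S) - 1) * c s3"
      using sum_c s3 card_S finite_S by (simp add: of_nat_diff)
    thus False
      using card_S nonzero[OF s3] by simp
  qed
  then obtain s1 where s1: "s1 \<in> S" "s1 \<noteq> s3" "c s1 + c s3 \<noteq> 0"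
    by blast
  have "card (S - {s1, s3}) \<noteq> 0"
    using card_S s1 s3 finite_S by (simp add: card_Diff_subset)
  hence "S - {s1, s3} \<noteq> {}"
    by (metis card.empty)
  then obtain s2 where "s2 \<in> S" "s2 \<noteq> s1" "s2 \<noteq> s3"
    by blast
  thus thesis
    using s1 s3 by (intro that[of s1 s2 s3]) auto
qed

text \<open>
  Szemeredi's cube argument.  Fix \<open>x s\<close> to be \<open>g s\<close> for all \<open>s\<close> other than \<open>s1\<close>, \<open>s2\<close>, \<open>s3\<close>, and let
  \<open>X i\<close> be the set of values that the equation forces on \<open>x s3\<close> when \<open>x s1\<close> ranges over \<open>D1\<close> and \<open>x s2\<close>
  over the subcube spanned by the first \<open>i\<close> differences.  Up to degenerate solutions \<open>X i\<close> avoids \<open>A\<close>.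
  Passing from \<open>X i\<close> to \<open>X (Suc i)\<close> adds a translate by \<open>- Q\<close>, and for some \<open>i\<close> this adds few points,
  so the complement of \<open>X i\<close> consists of few progressions with difference \<open>Q\<close>.
\<close>

lemma card_free_le:
  fixes A D :: "int set" and N n d T :: nat and b :: int and q :: "nat \<Rightarrow> int" and \<theta> l :: real
  assumes s: "s1 \<in> S" "s2 \<in> S" "s3 \<in> S" "s1 \<noteq> s2" "s1 \<noteq> s3" "s2 \<noteq> s3" "c s1 + c s3 \<noteq> 0"
    and A: "A \<subseteq> {0..<int N}" "eqn_free S c A"
    and N: "int N = 4 * norm_c * int n" "n > 0"
    and DA: "D \<subseteq> A" and mid: "\<And>x. x \<in> D \<Longrightarrow> \<bar>x - 2 * norm_c * int n\<bar> \<le> int n"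
    and cong: "\<And>x y. x \<in> D \<Longrightarrow> y \<in> D \<Longrightarrow> c s3 dvd x - y"
    and g: "g ` (S - {s1, s2, s3}) \<subseteq> D" "inj_on g (S - {s1, s2, s3})"
    and q: "\<And>i. i < d \<Longrightarrow> 1 \<le> q i \<and> q i \<le> int T"
    and cube: "\<And>J. J \<subseteq> {..<d} \<Longrightarrow> b + (\<Sum>j\<in>J. q j) \<in> D - g ` (S - {s1, s2, s3})"
    and bound: "\<And>m. real (max_free m) \<le> \<theta> * real m + l"
    and pos: "\<theta> \<ge> 0" "l \<ge> 0" "d > 0"
  shows "real (card A) \<le> \<theta> * (real N - (real (card D) - real (card S) - 2 ^ d))
    + l * (2 * norm_c * real T + real N / real d) + 2 ^ d + 2 ^ d + real (card S)"
proof -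
  define R where "R = S - {s1, s2, s3}"
  define K where "K = (\<Sum>r\<in>R. c r * g r)"
  define M where "M i = (\<lambda>J. b + (\<Sum>j\<in>J. q j)) ` Pow {..<i}" for i :: nat
  \<comment> \<open>Removing the values of \<open>g\<close> and the whole cube makes
    \<open>x1\<close> differ from every other fixed value.\<close>
  define D1 where "D1 = D - g ` R - M d"
  define X where "X i = {v. \<exists>x1\<in>D1. \<exists>x2\<in>M i. c s1 * x1 + c s2 * x2 + c s3 * v + K = 0}" for i
  have finR: "finite R"
    using finite_S by (simp add: R_def)
  have finA: "finite A"
    using A(1) finite_subset by blast
  have finD: "finite D"
    using DA finA finite_subset by blast
  have split: "(\<Sum>s\<in>S. f s) = f s1 + f s2 + f s3 + (\<Sum>r\<in>R. f r)" for f :: "'a \<Rightarrow> int"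
  proof -
    have "S = insert s1 (insert s2 (insert s3 R))"
      using s by (auto simp: R_def)
    moreover have "s3 \<notin> R" "s2 \<notin> insert s3 R" "s1 \<notin> insert s2 (insert s3 R)"
      using s by (auto simp: R_def)
    ultimately show ?thesis
      using finR by (simp add: algebra_simps)
  qed
  have sum_R: "(\<Sum>r\<in>R. c r) = - (c s1 + c s2 + c s3)"
    using split[of c] sum_c by simp
  have c3: "c s3 \<noteq> 0"
    using nonzero s by blast
  have MD: "M i \<subseteq> D - g ` R" if "i \<le> d" for i
  proof
    fix x assume "x \<in> M i"
    then obtain J where "J \<subseteq> {..<i}" "x = b + (\<Sum>j\<in>J. q j)"
      by (auto simp: M_def)
    moreover from this have "J \<subseteq> {..<d}"
      using that by force
    ultimately show "x \<in> D - g ` R"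
      using cube[of J] unfolding R_def by simp
  qed
  have M_mono: "M i \<subseteq> M j" if "i \<le> j" for i j
    using that unfolding M_def by (intro image_mono Pow_mono) auto
  have finM: "finite (M i)" for i
    by (simp add: M_def)
  have cM: "card (M d) \<le> 2 ^ d"
    unfolding M_def using card_image_le[of "Pow {..<d}"] by (simp add: card_Pow)
  have M0: "M 0 = {b}"
    by (simp add: M_def)
  have bM: "b \<in> M i" for i
    using M_mono[of 0 i] M0 by auto
  have bD: "b \<in> D"
    using MD[of 0] M0 by auto

  \<comment> \<open>The equation is unchanged under recentring at the midpoint \<open>z\<close> of
    \<open>{0..<N}\<close>. The other variables deviate from \<open>z\<close> by at most
    \<open>n\<close>, so the forced value deviates by at most \<open>norm_c * n\<close>.\<close>
  have XN: "X i \<subseteq> {0..<int N}" if id: "i \<le> d" for i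
  proof
    fix v assume "v \<in> X i"
    then obtain x1 x2 where x: "x1 \<in> D" "x2 \<in> D" "c s1 * x1 + c s2 * x2 + c s3 * v + K = 0"
      using MD[OF id] by (auto simp: X_def D1_def)
    define z where "z = 2 * norm_c * int n"
    define e where "e s = (if s = s1 then x1 - z else if s = s2 then x2 - z
      else if s = s3 then 0 else g s - z)" for s
    have e: "\<bar>e s\<bar> \<le> int n" if "s \<in> S" for s
    proof -
      have "g s \<in> D" if "s \<notin> {s1, s2, s3}"
        using that \<open>s \<in> S\<close> g(1) by blast
      thus ?thesis
        using mid[of x1] mid[of x2] mid[of "g s"] x unfolding e_def z_def by auto
    qed
    have "(\<Sum>r\<in>R. c r * e r) = (\<Sum>r\<in>R. c r * g r - z * c r)"
      by (rule sum.cong) (auto simp: e_def R_def algebra_simps)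
    hence eR: "(\<Sum>r\<in>R. c r * e r) = K - z * (\<Sum>r\<in>R. c r)"
      by (simp add: K_def sum_subtractf sum_distrib_left)
    have "(\<Sum>s\<in>S. c s * e s) = c s1 * (x1 - z) + c s2 * (x2 - z) + K + z * (c s1 + c s2 + c s3)"
      unfolding split[of "\<lambda>s. c s * e s"] eR sum_R using s by (simp add: e_def algebra_simps)
    also have "\<dots> = - (c s3 * (v - z))"
      using x(3) by (simp add: algebra_simps)
    finally have "\<bar>c s3 * (v - z)\<bar> \<le> norm_c * int n"
      using abs_sum_mult_le[of S e "int n" c] e by (simp add: norm_c_def)
    moreover have "1 * \<bar>v - z\<bar> \<le> \<bar>c s3\<bar> * \<bar>v - z\<bar>"
      using c3 by (intro mult_right_mono) auto
    ultimately have "\<bar>v - z\<bar> \<le> norm_c * int n"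
      by (simp add: abs_mult)
    moreover have "0 < norm_c * int n"
      using norm_c_ge_1 N(2) by (intro mult_pos_pos) auto
    ultimately show "v \<in> {0..<int N}"
      unfolding N(1) z_def by (simp add: mult.assoc) linarith
  qed
  have finX: "finite (X i)" if "i \<le> d" for i
    using XN[OF that] finite_subset by blast

  \<comment> \<open>Already \<open>x2 = b\<close> yields a forced value for each \<open>x1\<close>:
    it is an integer because \<open>D\<close> lies in one residue class modulo \<open>c s3\<close>
    and \<open>c\<close> sums to \<open>0\<close>, and it determines \<open>x1\<close>.\<close>
  have "card D1 \<le> card (X 0)"
  proof -
    have "\<exists>v. c s1 * x + c s2 * b + c s3 * v + K = 0" if "x \<in> D1" for x
    proof -
      have "c s3 dvd c s1 * (x - b)"
        using cong[of x b] bD that by (auto simp: D1_def)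
      moreover have "c s3 dvd (\<Sum>r\<in>R. c r * (g r - b))"
        using cong[OF _ bD] g(1) by (intro dvd_sum dvd_mult) (auto simp: R_def)
      moreover have "(\<Sum>r\<in>R. c r * (g r - b)) = K - b * (\<Sum>r\<in>R. c r)"
        by (simp add: K_def right_diff_distrib sum_subtractf sum_distrib_left mult.commute)
      ultimately have "c s3 dvd c s1 * (x - b) + (K - b * (\<Sum>r\<in>R. c r)) - c s3 * b"
        by (metis dvd_add dvd_diff dvd_triv_left)
      also have "\<dots> = c s1 * x + c s2 * b + K"
        unfolding sum_R by (simp add: algebra_simps)
      finally obtain v where "c s1 * x + c s2 * b + K = c s3 * v"
        by (auto elim: dvdE)
      thus ?thesis
        by (intro exI[of _ "- v"]) simp
    qed
    then obtain f where f: "\<And>x. x \<in> D1 \<Longrightarrow> c s1 * x + c s2 * b + c s3 * f x + K = 0"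
      by metis
    have "inj_on f D1"
    proof (rule inj_onI)
      fix x y assume xy: "x \<in> D1" "y \<in> D1" "f x = f y"
      have "c s1 * x = c s1 * y"
        using f[OF xy(1)] f[OF xy(2)] unfolding xy(3) by linarith
      thus "x = y"
        using nonzero[OF s(1)] by simp
    qed
    moreover have "f ` D1 \<subseteq> X 0"
      using f M0 by (auto simp: X_def)
    ultimately show ?thesis
      using finX[of 0] by (intro card_inj_on_le) auto
  qed
  hence X_large: "card D1 \<le> card (X i)" if "i \<le> d" for i
    using card_mono[OF finX[OF that], of "X 0"] M_mono[of 0 i] by (fastforce simp: X_def)

  \<comment> \<open>The increments telescope to at most \<open>N\<close>, so one of the
    \<open>d\<close> steps adds at most the average.\<close>
  have "\<exists>i<d. real (card (X (Suc i))) - real (card (X i)) \<le> real N / real d"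
  proof (rule ccontr)
    assume "\<not> ?thesis"
    hence "(\<Sum>i<d. real N / real d) < (\<Sum>i<d. real (card (X (Suc i))) - real (card (X i)))"
      using pos(3) by (intro sum_strict_mono) auto
    also have "\<dots> = real (card (X d)) - real (card (X 0))"
      by (rule sum_lessThan_telescope)
    also have "card (X d) \<le> N"
      using card_mono[OF _ XN[of d]] by simp
    finally show False
      using pos(3) by simp
  qed
  then obtain i where i: "i < d" "real (card (X (Suc i))) - real (card (X i)) \<le> real N / real d"
    by blast
  have "b + q i \<in> D"
    using cube[of "{i}"] i by simp
  hence "c s3 dvd q i"
    using cong[of "b + q i" b] bD by simp
  \<comment> \<open>Raising \<open>x2\<close> by \<open>q i\<close> lowers the forced value by
    \<open>Q = c s2 * q i / c s3\<close>.\<close>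
  then obtain Q where Q: "c s2 * q i = c s3 * Q"
    by (metis dvd_mult dvd_def)
  have Q0: "Q \<noteq> 0"
    using Q nonzero[OF s(2)] q[OF i(1)] by auto
  have "1 * \<bar>Q\<bar> \<le> \<bar>c s3\<bar> * \<bar>Q\<bar>"
    using c3 by (intro mult_right_mono) auto
  also have "\<dots> = \<bar>c s2\<bar> * q i"
    using q[OF i(1)] by (simp add: abs_mult[symmetric] Q[symmetric]) (simp add: abs_mult)
  also have "\<dots> \<le> norm_c * int T"
    using q[OF i(1)] abs_c_le[OF s(2)] norm_c_ge_1 by (intro mult_mono) auto
  finally have QT: "\<bar>Q\<bar> \<le> norm_c * int T"
    by simp
  have shift: "v - Q \<in> X (Suc i)" if v: "v \<in> X i" for v
  proof -
    obtain x1 x2 where x: "x1 \<in> D1" "x2 \<in> M i" "c s1 * x1 + c s2 * x2 + c s3 * v + K = 0"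
      using v by (auto simp: X_def)
    then obtain J where J: "J \<subseteq> {..<i}" "x2 = b + (\<Sum>j\<in>J. q j)"
      by (auto simp: M_def)
    have "finite J" "i \<notin> J"
      using J finite_subset by auto
    hence "x2 + q i = b + (\<Sum>j\<in>insert i J. q j)"
      using J by simp
    moreover have "insert i J \<in> Pow {..<Suc i}"
      using J by (auto simp: less_Suc_eq)
    ultimately have "x2 + q i \<in> M (Suc i)"
      unfolding M_def by blast
    moreover have "c s1 * x1 + c s2 * (x2 + q i) + c s3 * (v - Q) + K = 0"
      using x(3) Q by (simp add: algebra_simps)
    ultimately show ?thesis
      using x(1) unfolding X_def by blast
  qed
  \<comment> \<open>A step by \<open>Q\<close> leaves \<open>Y\<close> only within
    \<open>\<bar>Q\<bar>\<close> of an end of the interval or by entering \<open>X i\<close>; in the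
    latter case the starting point lies in \<open>X (Suc i) - X i\<close>.\<close>
  define Y where "Y = {0..<int N} - X i"
  have finY: "finite Y"
    by (simp add: Y_def)
  have "{y\<in>Y. y + Q \<notin> Y} \<subseteq> {0..<\<bar>Q\<bar>} \<union> {int N - \<bar>Q\<bar>..<int N} \<union> (X (Suc i) - X i)"
  proof
    fix y assume "y \<in> {y\<in>Y. y + Q \<notin> Y}"
    hence y: "0 \<le> y" "y < int N" "y \<notin> X i" "y + Q < 0 \<or> int N \<le> y + Q \<or> y + Q \<in> X i"
      by (auto simp: Y_def)
    thus "y \<in> {0..<\<bar>Q\<bar>} \<union> {int N - \<bar>Q\<bar>..<int N} \<union> (X (Suc i) - X i)"
      using shift[of "y + Q"] by auto
  qed
  hence "card {y\<in>Y. y + Q \<notin> Y} \<le> card ({0..<\<bar>Q\<bar>} \<union> {int N - \<bar>Q\<bar>..<int N} \<union> (X (Suc i) - X i))"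
    using finX[of "Suc i"] i(1) by (intro card_mono) auto
  also have "\<dots> \<le> card {0..<\<bar>Q\<bar>} + card {int N - \<bar>Q\<bar>..<int N} + card (X (Suc i) - X i)"
    by (meson card_Un_le order_trans add_right_mono)
  finally have "real (card {y\<in>Y. y + Q \<notin> Y}) \<le> 2 * real_of_int \<bar>Q\<bar> + real (card (X (Suc i) - X i))"
    by simp
  also have "X i \<subseteq> X (Suc i)"
    using M_mono[of i "Suc i"] by (fastforce simp: X_def)
  hence "real (card (X (Suc i) - X i)) = real (card (X (Suc i))) - real (card (X i))"
    using finX[of i] finX[of "Suc i"] i(1) card_mono[OF finX[of "Suc i"], of "X i"]
    by (simp add: card_Diff_subset of_nat_diff)
  also have "\<dots> \<le> real N / real d"
    by (rule i(2))
  also have "real_of_int \<bar>Q\<bar> \<le> real_of_int (norm_c * int T)"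
    using QT by (simp only: of_int_le_iff)
  finally have exits: "real (card {y\<in>Y. y + Q \<notin> Y}) \<le> 2 * norm_c * real T + real N / real d"
    by simp

  have cY: "real (card Y) \<le> real N - (real (card D) - real (card S) - 2 ^ d)"
  proof -
    have "card (g ` R) \<le> card S"
      using card_image_le[OF finR, of g] card_mono[OF finite_S, of R] by (simp add: R_def)
    moreover have "D \<subseteq> D1 \<union> g ` R \<union> M d"
      by (auto simp: D1_def)
    hence "card D \<le> card (D1 \<union> g ` R \<union> M d)"
      using finD finR finM by (intro card_mono) (auto simp: D1_def)
    hence "card D \<le> card D1 + card (g ` R) + card (M d)"
      by (meson card_Un_le order_trans add_right_mono)
    ultimately have "card D \<le> card (X i) + card S + 2 ^ d"
      using X_large[of i] i(1) cM by linarith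
    moreover have "card Y + card (X i) = N"
      using card_Diff_subset[OF finX[of i] XN[of i]] card_mono[OF _ XN[of i]] i(1)
      by (simp add: Y_def)
    ultimately have "card Y + card D \<le> N + card S + 2 ^ d"
      by linarith
    hence "real (card Y + card D) \<le> real (N + card S + 2 ^ d)"
      by (simp only: of_nat_le_iff)
    thus ?thesis
      by simp
  qed

  have AX: "card (A \<inter> X i) \<le> 2 ^ d + 2 ^ d + card S"
  proof -
    \<comment> \<open>The values with \<open>v = x1\<close>: then
      \<open>(c s1 + c s3) * v = - (c s2 * x2 + K)\<close>, so \<open>v\<close> is determined by
      \<open>x2\<close> and there are at most \<open>2 ^ d\<close> of them.\<close>
    define E where "E = (\<lambda>x. - (c s2 * x + K) div (c s1 + c s3)) ` M d"
    have "A \<inter> X i \<subseteq> M d \<union> E \<union> g ` R"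
    proof
      fix v assume v: "v \<in> A \<inter> X i"
      then obtain x1 x2 where x: "x1 \<in> D1" "x2 \<in> M i" "c s1 * x1 + c s2 * x2 + c s3 * v + K = 0"
        by (auto simp: X_def)
      have x2: "x2 \<in> M d"
        using x(2) M_mono[of i d] i(1) by auto
      show "v \<in> M d \<union> E \<union> g ` R"
      proof (rule ccontr)
        assume nv: "v \<notin> M d \<union> E \<union> g ` R"
        have "v \<noteq> x1"
        proof
          assume "v = x1"
          hence "- (c s2 * x2 + K) = v * (c s1 + c s3)"
            using x(3) by (simp add: algebra_simps)
          hence "- (c s2 * x2 + K) div (c s1 + c s3) = v"
            using s(7) by simp
          thus False
            using x2 nv unfolding E_def by blast
        qed
        define w where "w s = (if s = s1 then x1 else if s = s2 then x2 else if s = s3 then v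
          else g s)" for s
        have wR: "w r = g r" if "r \<in> R" for r
          using that by (auto simp: w_def R_def)
        have w123: "w s1 = x1" "w s2 = x2" "w s3 = v"
          using s by (auto simp: w_def)
        have Seq: "S = insert s1 (insert s2 (insert s3 R))"
          using s by (auto simp: R_def)
        have "(\<Sum>r\<in>R. c r * w r) = K"
          unfolding K_def using wR by (intro sum.cong) auto
        hence zero: "(\<Sum>s\<in>S. c s * w s) = 0"
          using split[of "\<lambda>s. c s * w s"] w123 x(3) by simp
        have "inj_on g R" "g ` R \<subseteq> D"
          using g by (simp_all add: R_def)
        have wRR: "w ` R = g ` R"
          by (rule image_cong[OF refl wR])
        have "inj_on w R"
          using \<open>inj_on g R\<close> inj_on_cong[of R w g] wR by blast
        moreover have x1: "x1 \<notin> g ` R" "x1 \<noteq> x2" "x1 \<in> D" and x2': "x2 \<notin> g ` R" "x2 \<in> D"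
          using x(1) MD[of d] x2 by (auto simp: D1_def)
        moreover have "v \<noteq> x2" "v \<notin> g ` R"
          using nv x2 by blast+
        ultimately have "inj_on w S"
          unfolding Seq inj_on_insert w123 using \<open>v \<noteq> x1\<close> wRR
          by (simp only: image_insert image_Un w123 Diff_insert_absorb) (auto simp: w123)
        moreover have "w ` S \<subseteq> A"
          unfolding Seq image_insert w123 wRR using v x1(3) x2'(2) \<open>g ` R \<subseteq> D\<close> DA by blast
        ultimately show False
          using A(2) zero unfolding eqn_free_def by blast
      qed
    qed
    hence "card (A \<inter> X i) \<le> card (M d \<union> E \<union> g ` R)"
      using finM finR by (intro card_mono) (auto simp: E_def)
    hence "card (A \<inter> X i) \<le> card (M d) + card E + card (g ` R)"
      by (meson card_Un_le order_trans add_right_mono)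
    moreover have "card E \<le> card (M d)"
      unfolding E_def using finM by (rule card_image_le)
    moreover have "card (g ` R) \<le> card S"
      using card_image_le[OF finR, of g] card_mono[OF finite_S, of R] by (simp add: R_def)
    ultimately show ?thesis
      using cM by linarith
  qed

  have "real (card (A \<inter> Y)) \<le> \<theta> * real (card Y) + l * real (card {y\<in>Y. y + Q \<notin> Y})"
    using A(2) finY Q0 bound by (rule card_le_by_runs)
  also have "\<dots> \<le> \<theta> * (real N - (real (card D) - real (card S) - 2 ^ d))
      + l * (2 * norm_c * real T + real N / real d)"
    using cY exits pos by (intro add_mono mult_left_mono) auto
  finally have AY: "real (card (A \<inter> Y)) \<le> \<theta> * (real N - (real (card D) - real (card S) - 2 ^ d))
      + l * (2 * norm_c * real T + real N / real d)" .
  have "A = (A \<inter> X i) \<union> (A \<inter> Y)"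
    using A(1) by (auto simp: Y_def)
  hence "card A \<le> card (A \<inter> X i) + card (A \<inter> Y)"
    by (metis card_Un_le)
  hence "card A \<le> 2 ^ d + 2 ^ d + card S + card (A \<inter> Y)"
    using AX by linarith
  hence "real (card A) \<le> real (2 ^ d + 2 ^ d + card S + card (A \<inter> Y))"
    by (simp only: of_nat_le_iff)
  thus ?thesis
    using AY by simp
qed

end

lemma large_residue_class:
  fixes B :: "int set" and m :: int
  assumes "finite B" "m > 0"
  obtains D where "D \<subseteq> B" "card B \<le> nat m * card D" "\<And>x y. x \<in> D \<Longrightarrow> y \<in> D \<Longrightarrow> m dvd x - y"
proof -
  have "\<exists>r\<in>{0..<m}. card B \<le> nat m * card {x\<in>B. x mod m = r}"
  proof (rule ccontr)
    assume no: "\<not> ?thesis"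
    have "B \<subseteq> (\<Union>r\<in>{0..<m}. {x\<in>B. x mod m = r})"
      using assms by auto
    hence "card B \<le> card (\<Union>r\<in>{0..<m}. {x\<in>B. x mod m = r})"
      using assms by (intro card_mono) auto
    also have "\<dots> \<le> (\<Sum>r\<in>{0..<m}. card {x\<in>B. x mod m = r})"
      by (rule card_UN_le) simp
    finally have "nat m * card B \<le> (\<Sum>r\<in>{0..<m}. nat m * card {x\<in>B. x mod m = r})"
      by (simp add: sum_distrib_left[symmetric])
    also have "\<dots> < (\<Sum>r\<in>{0..<m}. card B)"
      using no assms by (intro sum_strict_mono) (auto simp: not_le)
    also have "\<dots> = nat m * card B"
      by simp
    finally show False
      by simp
  qed
  then obtain r where r: "card B \<le> nat m * card {x\<in>B. x mod m = r}"
    by blast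
  show thesis
    by (rule that[of "{x\<in>B. x mod m = r}"]) (use r in \<open>auto simp flip: mod_eq_dvd_iff\<close>)
qed

context invariant_equation
begin

lemma limit_density_nonneg: "0 \<le> limit_density"
  unfolding limit_density_def by (intro cInf_greatest) auto

lemma limit_density_le_1: "limit_density \<le> 1"
  using limit_density_le[of 1] max_free_le[of 1] by simp

text \<open>A largest free set \<open>A\<close> has at least \<open>\<rho> * N\<close> elements, but
  by the cube argument it essentially avoids a set as large as \<open>D\<close> while having density
  at most \<open>\<rho> + \<eta>\<close> on the rest. The loss of
  \<open>(\<rho> + \<eta>) * card D\<close> exceeds all error terms.\<close>

lemma limit_density_eq_0: "limit_density = 0"
proof (rule ccontr)
  define \<rho> where "\<rho> = limit_density"
  define C where "C = real_of_int norm_c"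
  assume "limit_density \<noteq> 0"
  hence \<rho>: "0 < \<rho>" "\<rho> \<le> 1"
    using limit_density_nonneg limit_density_le_1 by (auto simp: \<rho>_def)
  have C: "C \<ge> 1"
    using norm_c_ge_1 by (simp add: C_def)
  \<comment> \<open>The loss will be at least \<open>a * n\<close>; the remaining parameters make
    the errors add up to less.\<close>
  define a where "a = \<rho>\<^sup>2 / C"
  have a: "a > 0"
    using \<rho> C by (simp add: a_def)
  \<comment> \<open>Chosen so that \<open>\<eta> * N = a * n / 8\<close>.\<close>
  define \<eta> where "\<eta> = \<rho>\<^sup>2 / (32 * C\<^sup>2)"
  have \<eta>: "\<eta> > 0"
    using \<rho> C by (simp add: \<eta>_def)
  obtain l where l: "l \<ge> 0" "\<And>n. real (max_free n) \<le> (\<rho> + \<eta>) * real n + l"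
    using limit_density_approx[OF \<eta>] unfolding \<rho>_def by blast
  \<comment> \<open>The dimension makes the term \<open>l * N / d\<close> at most
    \<open>a * n / 8\<close>.\<close>
  define d where "d = nat \<lceil>32 * C * l / a\<rceil> + 1"
  have "32 * C * l / a \<le> real d"
    unfolding d_def by linarith
  hence d: "32 * C * l \<le> a * real d" "d > 0"
    using a by (auto simp: field_simps d_def)
  \<comment> \<open>Half of the lower bound \<open>\<rho> * n / C\<close> for \<open>card D\<close>,
    relative to a window of length \<open>2 * n\<close>; the other half allows for the values of
    \<open>g\<close>.\<close>
  define \<gamma> where "\<gamma> = \<rho> / (4 * C)"
  have "\<gamma> > 0"
    using \<rho> C by (simp add: \<gamma>_def)
  then obtain T N0 :: nat where cubes: "\<forall>N a D. N \<ge> N0 \<longrightarrow> D \<subseteq> {a..<a + int N} \<longrightarrow>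
      \<gamma> * real N \<le> real (card D) \<longrightarrow>
    (\<exists>b q. (\<forall>i<d. 1 \<le> q i \<and> q i \<le> int T) \<and> (\<forall>J\<subseteq>{..<d}. b + (\<Sum>j\<in>J. q j) \<in> D))"
    using hilbert_cube by blast
  \<comment> \<open>All error terms that stay bounded as \<open>n\<close> grows; \<open>n\<close> is
    then taken so large that \<open>W \<le> a * n / 2\<close>.\<close>
  define W where "W = (\<rho> + \<eta>) * (real (card S) + 2 ^ d) + l * (2 * C * real T)
    + 2 ^ d + 2 ^ d + real (card S)"
  define n where "n = N0 + nat \<lceil>2 * C * real (card S) / \<rho>\<rceil> + nat \<lceil>4 * l / \<rho>\<rceil> + nat \<lceil>2 * W / a\<rceil> + 1"
  have n: "n \<ge> N0" "n > 0"
    by (simp_all add: n_def)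
  have "2 * C * real (card S) / \<rho> \<le> real n" "4 * l / \<rho> \<le> real n" "2 * W / a \<le> real n"
    unfolding n_def by linarith+
  hence n': "2 * C * real (card S) \<le> \<rho> * real n" "4 * l \<le> \<rho> * real n" "2 * W \<le> a * real n"
    using \<rho> a by (auto simp: field_simps)
  define N where "N = nat (4 * norm_c * int n)"
  have intN: "int N = 4 * norm_c * int n"
    using norm_c_ge_1 by (simp add: N_def)
  have realN: "real N = 4 * C * real n"
    using intN unfolding C_def by (metis of_int_mult of_int_numeral of_int_of_nat_eq)
  obtain A where A: "A \<subseteq> {0..<int N}" "eqn_free S c A" "card A = max_free N"
    by (rule max_free_attained)
  have finA: "finite A"
    using A(1) finite_subset by blast
  have cA: "\<rho> * real N \<le> real (card A)"
    using limit_density_le[of N] A(3) by (simp add: \<rho>_def)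

  \<comment> \<open>The two outer intervals of length \<open>m\<close> hold at most
    \<open>(\<rho> + \<eta>) * m + l\<close> elements of \<open>A\<close> each, so the middle window
    of length \<open>2 * n\<close> must hold at least \<open>\<rho> * n\<close>.\<close>
  define m where "m = nat ((2 * norm_c - 1) * int n)"
  have intm: "int m = (2 * norm_c - 1) * int n"
    using norm_c_ge_1 by (simp add: m_def)
  have realm: "real m = (2 * C - 1) * real n"
  proof -
    have "real_of_int (int m) = real_of_int ((2 * norm_c - 1) * int n)"
      using intm by simp
    thus ?thesis by (simp add: C_def)
  qed
  define B where "B = A \<inter> {int m..<int m + 2 * int n}"
  have "A \<subseteq> (A \<inter> {0..<0 + int m}) \<union> B \<union> (A \<inter> {int m + 2 * int n..<int m + 2 * int n + int m})"
  proof
    fix x assume "x \<in> A"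
    moreover have "int N = int m + 2 * int n + int m"
      unfolding intN intm by (simp add: algebra_simps)
    ultimately show "x \<in> (A \<inter> {0..<0 + int m}) \<union> B \<union>
        (A \<inter> {int m + 2 * int n..<int m + 2 * int n + int m})"
      using A(1) by (auto simp: B_def)
  qed
  hence "card A \<le> card ((A \<inter> {0..<0 + int m}) \<union> B \<union>
      (A \<inter> {int m + 2 * int n..<int m + 2 * int n + int m}))"
    by (intro card_mono) (simp_all add: B_def finA)
  also have "\<dots> \<le> card (A \<inter> {0..<0 + int m}) + card B +
      card (A \<inter> {int m + 2 * int n..<int m + 2 * int n + int m})"
    by (meson card_Un_le order_trans add_right_mono)
  also have "\<dots> \<le> max_free m + card B + max_free m"
    by (intro add_mono order_refl card_interval_le A(2))
  finally have "real (card A) \<le> real (max_free m) + real (card B) + real (max_free m)"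
    by linarith
  hence "\<rho> * (4 * C * real n) \<le> 2 * ((\<rho> + \<eta>) * ((2 * C - 1) * real n) + l) + real (card B)"
    using l(2)[of m] cA realN realm by simp
  moreover have "\<eta> * ((2 * C - 1) * real n) \<le> \<rho> * real n / 4"
  proof -
    have "\<eta> * (2 * C - 1) \<le> \<eta> * (8 * C)"
      using \<eta> C by (intro mult_left_mono) auto
    also have "\<dots> = \<rho> * (\<rho> / C) / 4"
      using C by (simp add: \<eta>_def power2_eq_square)
    also have "\<dots> \<le> \<rho> * 1 / 4"
      using \<rho> C by (intro divide_right_mono mult_left_mono) auto
    finally have "\<eta> * (2 * C - 1) * real n \<le> \<rho> * 1 / 4 * real n"
      by (rule mult_right_mono) simp
    thus ?thesis by (simp add: mult.assoc)
  qed
  ultimately have cB: "\<rho> * real n \<le> real (card B)"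
    using n'(2) by (simp add: algebra_simps)

  obtain s1 s2 s3 where s: "s1 \<in> S" "s2 \<in> S" "s3 \<in> S" "s1 \<noteq> s2" "s1 \<noteq> s3" "s2 \<noteq> s3"
    "c s1 + c s3 \<noteq> 0"
    by (rule distinct_triple)
  have "finite B"
    using finA by (simp add: B_def)
  moreover have "\<bar>c s3\<bar> > 0"
    using nonzero[OF s(3)] by simp
  \<comment> \<open>Passing to one residue class modulo \<open>c s3\<close> costs a factor of at
    most \<open>C\<close>.\<close>
  ultimately obtain D where D: "D \<subseteq> B" "card B \<le> nat \<bar>c s3\<bar> * card D"
    "\<And>x y. x \<in> D \<Longrightarrow> y \<in> D \<Longrightarrow> \<bar>c s3\<bar> dvd x - y"
    using large_residue_class by metis
  have finD: "finite D"
    using D(1) \<open>finite B\<close> finite_subset by blast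
  have "real (card B) \<le> real (nat \<bar>c s3\<bar>) * real (card D)"
    using D(2) by (metis of_nat_le_iff of_nat_mult)
  also have "real (nat \<bar>c s3\<bar>) \<le> C"
    using abs_c_le[OF s(3)] by (simp add: C_def)
  finally have "\<rho> * real n \<le> C * real (card D)"
    using cB by (simp add: mult_right_mono)
  hence cD: "\<rho> * real n / C \<le> real (card D)"
    using C by (simp add: field_simps)
  have k: "2 * real (card S) \<le> \<rho> * real n / C"
    using n'(1) C by (simp add: field_simps)
  have "card (S - {s1, s2, s3}) \<le> card S"
    by (rule card_mono) (use finite_S in auto)
  moreover from this have "card (S - {s1, s2, s3}) \<le> card D"
    using k cD by linarith
  ultimately obtain g where g: "g ` (S - {s1, s2, s3}) \<subseteq> D" "inj_on g (S - {s1, s2, s3})"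
    using card_le_inj[of "S - {s1, s2, s3}" D] finite_S finD by auto
  define D' where "D' = D - g ` (S - {s1, s2, s3})"
  have "card (g ` (S - {s1, s2, s3})) \<le> card S"
    using card_image_le[of "S - {s1, s2, s3}" g] \<open>card (S - {s1, s2, s3}) \<le> card S\<close> finite_S
    by (metis finite_Diff le_trans)
  hence "card D \<le> card D' + card S"
    using diff_card_le_card_Diff[of "g ` (S - {s1, s2, s3})" D] finite_S by (simp add: D'_def)
  hence "real (card D) \<le> real (card D') + real (card S)"
    by linarith
  hence "\<rho> * real n / C \<le> real (card D') + (\<rho> * real n / C) / 2"
    using cD k by argo
  moreover have "\<gamma> * real (2 * n) = \<rho> * real n / C / 2"
    using C by (simp add: \<gamma>_def)
  ultimately have "\<gamma> * real (2 * n) \<le> real (card D')"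
    by linarith
  moreover have "D' \<subseteq> {int m..<int m + int (2 * n)}"
    using D(1) by (auto simp: D'_def B_def)
  moreover have "2 * n \<ge> N0"
    using n by simp
  ultimately obtain b q where q: "\<forall>i<d. 1 \<le> q i \<and> q i \<le> int T"
    and b: "\<forall>J\<subseteq>{..<d}. b + (\<Sum>j\<in>J. q j) \<in> D'"
    using cubes by blast

  have mid: "\<bar>x - 2 * norm_c * int n\<bar> \<le> int n" if "x \<in> D" for x
  proof -
    have "int m \<le> x" "x < int m + 2 * int n"
      using that D(1) by (auto simp: B_def)
    thus ?thesis
      unfolding intm by (simp add: algebra_simps)
  qed
  have dvd: "c s3 dvd x - y" if "x \<in> D" "y \<in> D" for x y
    using D(3)[OF that] by simp
  have "real (card A) \<le> (\<rho> + \<eta>) * (real N - (real (card D) - real (card S) - 2 ^ d))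
    + l * (2 * norm_c * real T + real N / real d) + 2 ^ d + 2 ^ d + real (card S)"
  proof (rule card_free_le[OF s A(1,2) intN n(2) _ mid dvd g])
    show "D \<subseteq> A"
      using D(1) by (auto simp: B_def)
    show "\<And>i. i < d \<Longrightarrow> 1 \<le> q i \<and> q i \<le> int T"
      using q by blast
    show "\<And>J. J \<subseteq> {..<d} \<Longrightarrow> b + sum q J \<in> D - g ` (S - {s1, s2, s3})"
      using b unfolding D'_def by blast
  qed (use l \<rho> \<eta> d in auto)
  \<comment> \<open>The gains \<open>a * n / 8\<close>, \<open>a * n / 8\<close> and
    \<open>W \<le> a * n / 2\<close> fall short of the loss \<open>a * n\<close>.\<close>
  hence "\<rho> * real N \<le> \<rho> * real N + \<eta> * real N - (\<rho> + \<eta>) * real (card D) + l * (real N / real d) + W"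
    using cA unfolding W_def C_def by (simp add: algebra_simps)
  moreover have "\<eta> * real N = a * real n / 8"
    unfolding realN using C by (simp add: \<eta>_def a_def power2_eq_square)
  moreover have "l * (real N / real d) \<le> a * real n / 8"
  proof -
    have "l * (real N / real d) = 32 * C * l * (real n / (8 * real d))"
      unfolding realN by simp
    also have "\<dots> \<le> a * real d * (real n / (8 * real d))"
      using d by (intro mult_right_mono) auto
    also have "\<dots> = a * real n / 8"
      using d by simp
    finally show ?thesis .
  qed
  moreover have "a * real n \<le> (\<rho> + \<eta>) * real (card D)"
  proof -
    have "a * real n = \<rho> * (\<rho> * real n / C)"
      by (simp add: a_def power2_eq_square)
    also have "\<dots> \<le> (\<rho> + \<eta>) * real (card D)"
      using cD \<rho> \<eta> C by (intro mult_mono) auto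
    finally show ?thesis .
  qed
  moreover have "a * real n > 0"
    using a n by simp
  ultimately show False
    using n'(3) by linarith
qed

text \<open>A vanishing infimum provides one length \<open>N\<close> at which free sets have density
  below \<delta>; this \<open>N\<close> serves below as the length of windows modulo
  \<open>p\<close>.\<close>

theorem dense_set_not_free:
  assumes "\<delta> > 0"
  obtains N :: nat where "N > 0"
    "\<And>A. A \<subseteq> {0..<int N} \<Longrightarrow> \<delta> * real N \<le> real (card A) \<Longrightarrow> \<not> eqn_free S c A"
proof -
  have "\<exists>x\<in>(\<lambda>n. real (max_free n) / real n) ` {1..}. x < \<delta>"
    using limit_density_eq_0 assms unfolding limit_density_def by (intro cInf_lessD) auto
  then obtain N where N: "N \<ge> 1" "real (max_free N) < \<delta> * real N"
    by (auto simp: field_simps)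
  have "\<not> eqn_free S c A" if "A \<subseteq> {0..<int N}" "\<delta> * real N \<le> real (card A)" for A
    using card_le_max_free[OF that(1)] N(2) that(2) by linarith
  thus thesis
    using N(1) by (intro that[of N]) auto
qed

end

section \<open>Popular patterns\<close>

lemma card_translate_ge:
  fixes A :: "int set" and p :: nat
  assumes "p > 0" "A \<subseteq> {0..<int p}"
  shows "card A \<le> card {z\<in>{0..<int p}. (z + j) mod int p \<in> A}"
proof -
  have "inj_on (\<lambda>a. (a - j) mod int p) A"
  proof (rule inj_onI)
    fix x y assume xy: "x \<in> A" "y \<in> A" "(x - j) mod int p = (y - j) mod int p"
    hence "x mod int p = y mod int p"
      by (simp add: mod_eq_dvd_iff)
    thus "x = y"
      using xy(1,2) assms(2) by (simp add: subset_iff)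
  qed
  moreover have "(\<lambda>a. (a - j) mod int p) ` A \<subseteq> {z\<in>{0..<int p}. (z + j) mod int p \<in> A}"
  proof safe
    fix a assume a: "a \<in> A"
    have "((a - j) mod int p + j) mod int p = a mod int p"
      by (simp add: mod_simps)
    also have "\<dots> = a"
      using a assms(2) by (simp add: subset_iff)
    finally show "((a - j) mod int p + j) mod int p \<in> A"
      using a by simp
  qed (use assms(1) in auto)
  ultimately show ?thesis
    by (rule card_inj_on_le) (rule finite_subset[of _ "{0..<int p}"], auto)
qed

context invariant_equation
begin

text \<open>Every interval of length \<open>N\<close> in which \<open>A\<close> is dense contains one of boundedly many patterns.\<close>

lemma popular_pattern:
  assumes \<delta>: "\<delta> > 0"
  obtains \<delta>' :: real and N :: nat where "\<delta>' > 0"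
    "\<And>p A. p > 0 \<Longrightarrow> A \<subseteq> {0..<int p} \<Longrightarrow> \<delta> * real p \<le> real (card A) \<Longrightarrow>
      \<exists>t. t ` S \<subseteq> {0..<int N} \<and> inj_on t S \<and> (\<Sum>s\<in>S. c s * t s) = 0 \<and>
        \<delta>' * real p \<le> real (card {z\<in>{0..<int p}. \<forall>s\<in>S. (z + t s) mod int p \<in> A})"
proof -
  obtain N :: nat where N: "N > 0" and
    roth: "\<And>A. A \<subseteq> {0..<int N} \<Longrightarrow> \<delta> / 2 * real N \<le> real (card A) \<Longrightarrow> \<not> eqn_free S c A"
    using dense_set_not_free[of "\<delta> / 2"] \<delta> by auto
  \<comment> \<open>Finite and independent of \<open>p\<close>, so one of its patterns must be
    popular.\<close>
  define F where "F = {t \<in> S \<rightarrow>\<^sub>E {0..<int N}. inj_on t S \<and> (\<Sum>s\<in>S. c s * t s) = 0}"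
  have finF: "finite F"
    by (rule finite_subset[of _ "S \<rightarrow>\<^sub>E {0..<int N}"])
      (auto simp: F_def intro: finite_PiE finite_S)
  define \<delta>' where "\<delta>' = \<delta> / (2 * (real (card F) + 1))"
  have \<delta>': "\<delta>' > 0"
    using \<delta> by (simp add: \<delta>'_def add_nonneg_pos)
  have "\<exists>t. t ` S \<subseteq> {0..<int N} \<and> inj_on t S \<and> (\<Sum>s\<in>S. c s * t s) = 0 \<and>
        \<delta>' * real p \<le> real (card {z\<in>{0..<int p}. \<forall>s\<in>S. (z + t s) mod int p \<in> A})"
    if p: "p > 0" and A: "A \<subseteq> {0..<int p}" "\<delta> * real p \<le> real (card A)" for p A
  proof (rule ccontr)
    assume no: "\<not> ?thesis"
    define I where "I t = {z\<in>{0..<int p}. \<forall>s\<in>S. (z + t s) mod int p \<in> A}" for t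
    define B where "B z = {j\<in>{0..<int N}. (z + j) mod int p \<in> A}" for z
    \<comment> \<open>The windows in which \<open>A\<close> has density at least
      \<open>\<delta> / 2\<close>; each contains a pattern from \<open>F\<close>. If no pattern were
      popular, there would be fewer than \<open>\<delta> / 2 * p\<close> such windows.\<close>
    define G where "G = {z\<in>{0..<int p}. \<delta> / 2 * real N \<le> real (card (B z))}"
    have finI: "finite (I t)" for t
      by (rule finite_subset[of _ "{0..<int p}"]) (auto simp: I_def)
    have small: "real (card (I t)) \<le> \<delta>' * real p" if "t \<in> F" for t
      using no that unfolding F_def I_def by (fastforce simp: PiE_iff)
    have "G \<subseteq> (\<Union>t\<in>F. I t)"
    proof
      fix z assume z: "z \<in> G"
      have "\<not> eqn_free S c (B z)"
        using z by (intro roth) (auto simp: G_def B_def)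
      then obtain x where x: "x ` S \<subseteq> B z" "inj_on x S" "(\<Sum>s\<in>S. c s * x s) = 0"
        unfolding eqn_free_def by blast
      have "restrict x S \<in> F"
        using x by (auto simp: F_def B_def PiE_iff inj_on_def image_subset_iff)
      moreover have "z \<in> I (restrict x S)"
        using x z by (auto simp: I_def B_def G_def)
      ultimately show "z \<in> (\<Union>t\<in>F. I t)"
        by blast
    qed
    hence "card G \<le> card (\<Union>t\<in>F. I t)"
      using finF finI by (intro card_mono finite_UN_I)
    also have "\<dots> \<le> (\<Sum>t\<in>F. card (I t))"
      using finF by (rule card_UN_le)
    finally have "real (card G) \<le> (\<Sum>t\<in>F. real (card (I t)))"
      by (simp flip: of_nat_sum)
    also have "\<dots> \<le> (\<Sum>t\<in>F. \<delta>' * real p)"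
      using small by (rule sum_mono)
    also have "\<dots> < (real (card F) + 1) * \<delta>' * real p"
      using \<delta>' p by (simp add: algebra_simps)
    also have "\<dots> = \<delta> / 2 * real p"
      unfolding \<delta>'_def by (simp add: field_simps)
    finally have G: "real (card G) < \<delta> / 2 * real p" .
    \<comment> \<open>Double counting of the pairs \<open>(z, j)\<close> with
      \<open>(z + j) mod p\<close> in \<open>A\<close> shows that there are at least
      \<open>\<delta> / 2 * p\<close> dense windows.\<close>
    have "N * card A = (\<Sum>j\<in>{0..<int N}. card A)"
      by simp
    also have "\<dots> \<le> (\<Sum>j\<in>{0..<int N}. card {z\<in>{0..<int p}. (z + j) mod int p \<in> A})"
      by (intro sum_mono card_translate_ge p A)
    also have "\<dots> = (\<Sum>j\<in>{0..<int N}. \<Sum>z\<in>{0..<int p}. if (z + j) mod int p \<in> A then 1 else 0)"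
      by (simp add: sum.If_cases Int_def)
    also have "\<dots> = (\<Sum>z\<in>{0..<int p}. \<Sum>j\<in>{0..<int N}. if (z + j) mod int p \<in> A then 1 else 0)"
      by (rule sum.swap)
    also have "\<dots> = (\<Sum>z\<in>{0..<int p}. card (B z))"
      by (simp add: sum.If_cases Int_def B_def)
    finally have "real (N * card A) \<le> (\<Sum>z\<in>{0..<int p}. real (card (B z)))"
      unfolding of_nat_sum[symmetric] of_nat_le_iff .
    also have "\<dots> \<le> (\<Sum>z\<in>{0..<int p}. (if z \<in> G then real N else 0) + \<delta> / 2 * real N)"
    proof (intro sum_mono)
      fix z assume z: "z \<in> {0..<int p}"
      have "B z \<subseteq> {0..<int N}"
        by (auto simp: B_def)
      hence "card (B z) \<le> N"
        using card_mono[of "{0..<int N}" "B z"] by simp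
      thus "real (card (B z)) \<le> (if z \<in> G then real N else 0) + \<delta> / 2 * real N"
        using z \<delta> N by (auto simp: G_def intro: add_increasing2)
    qed
    also have "\<dots> = real N * real (card G) + \<delta> / 2 * real N * real p"
      by (simp add: sum.distrib sum.If_cases G_def Int_def)
    finally have "real N * real (card A) \<le> real N * (real (card G) + \<delta> / 2 * real p)"
      by (simp add: algebra_simps)
    hence "real (card A) \<le> real (card G) + \<delta> / 2 * real p"
      using N by simp
    thus False
      using G A(2) by simp
  qed
  thus thesis
    by (rule that[OF \<delta>'])
qed

end

text \<open>For two indices the zero pattern is taken and the set of points is \<open>A\<close>
  itself. The two values are then separated by the walk, which moves one of them.\<close>

lemma popular_zero_sum_pattern:
  fixes c :: "'a \<Rightarrow> int"
  assumes S: "finite S" "card S \<ge> 2" "\<And>s. s \<in> S \<Longrightarrow> c s \<noteq> 0" "(\<Sum>s\<in>S. c s) = 0"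
    and \<delta>: "\<delta> > 0"
  obtains \<delta>' :: real and N :: nat where "\<delta>' > 0"
    "\<And>p A. p > 0 \<Longrightarrow> A \<subseteq> {0..<int p} \<Longrightarrow> \<delta> * real p \<le> real (card A) \<Longrightarrow>
      \<exists>t. t ` S \<subseteq> {0..<int N} \<and> (card S \<ge> 3 \<longrightarrow> inj_on t S) \<and> (\<Sum>s\<in>S. c s * t s) = 0 \<and>
        \<delta>' * real p \<le> real (card {z\<in>{0..<int p}. \<forall>s\<in>S. (z + t s) mod int p \<in> A})"
proof (cases "card S \<ge> 3")
  case True
  then interpret invariant_equation S c
    using S by unfold_locales auto
  obtain \<delta>' :: real and N :: nat where *: "\<delta>' > 0"
    "\<And>p A. p > 0 \<Longrightarrow> A \<subseteq> {0..<int p} \<Longrightarrow> \<delta> * real p \<le> real (card A) \<Longrightarrow>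
      \<exists>t. t ` S \<subseteq> {0..<int N} \<and> inj_on t S \<and> (\<Sum>s\<in>S. c s * t s) = 0 \<and>
        \<delta>' * real p \<le> real (card {z\<in>{0..<int p}. \<forall>s\<in>S. (z + t s) mod int p \<in> A})"
    by (rule popular_pattern[OF \<delta>]) (rule that)
  show thesis
  proof (rule that[OF *(1)])
    fix p :: nat and A assume "p > 0" "A \<subseteq> {0..<int p}" "\<delta> * real p \<le> real (card A)"
    from *(2)[OF this] obtain t where "t ` S \<subseteq> {0..<int N}" "inj_on t S" "(\<Sum>s\<in>S. c s * t s) = 0"
      "\<delta>' * real p \<le> real (card {z\<in>{0..<int p}. \<forall>s\<in>S. (z + t s) mod int p \<in> A})"
      by (elim exE conjE) (rule that)
    thus "\<exists>t. t ` S \<subseteq> {0..<int N} \<and> (card S \<ge> 3 \<longrightarrow> inj_on t S) \<and> (\<Sum>s\<in>S. c s * t s) = 0 \<and>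
        \<delta>' * real p \<le> real (card {z\<in>{0..<int p}. \<forall>s\<in>S. (z + t s) mod int p \<in> A})"
      by (intro exI[of _ t] conjI impI)
  qed
next
  case False
  have "S \<noteq> {}"
    using S by auto
  show thesis
  proof (rule that[OF \<delta>, of 1])
    fix p A assume A: "A \<subseteq> {0..<int p}" "\<delta> * real p \<le> real (card A)"
    have eq: "{z\<in>{0..<int p}. \<forall>s\<in>S. (z + 0) mod int p \<in> A} = A"
      using \<open>S \<noteq> {}\<close> A(1) by (auto simp: subset_iff)
    show "\<exists>t. t ` S \<subseteq> {0..<int 1} \<and> (card S \<ge> 3 \<longrightarrow> inj_on t S) \<and> (\<Sum>s\<in>S. c s * t s) = 0 \<and>
        \<delta> * real p \<le> real (card {z\<in>{0..<int p}. \<forall>s\<in>S. (z + t s) mod int p \<in> A})"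
      by (intro exI[of _ "\<lambda>_. 0"] conjI impI) (unfold eq, use A(2) False in auto)
  qed
qed

section \<open>Independent sets in digraphs of bounded out-degree\<close>

text \<open>The average in-degree equals the average out-degree, so some vertex has in-degree at
  most \<open>d\<close>. Keeping it and deleting its at most \<open>2 * d\<close> neighbours gives
  the set greedily.\<close>

lemma exists_independent_of_bounded_outdegree:
  assumes "finite V" and "\<And>v. v \<in> V \<Longrightarrow> card {w\<in>V. w \<noteq> v \<and> E v w} \<le> d"
  shows "\<exists>W\<subseteq>V. (\<forall>u\<in>W. \<forall>v\<in>W. u \<noteq> v \<longrightarrow> \<not> E u v) \<and> card V \<le> (2 * d + 1) * card W"
  using assms
proof (induction "card V" arbitrary: V rule: less_induct)
  case less
  show ?case
  proof (cases "V = {}")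
    case False
    have "\<exists>v\<in>V. card {u\<in>V. u \<noteq> v \<and> E u v} \<le> d"
    proof (rule ccontr)
      assume no: "\<not> ?thesis"
      have "(\<Sum>v\<in>V. d) < (\<Sum>v\<in>V. card {u\<in>V. u \<noteq> v \<and> E u v})"
        using no less.prems(1) False by (intro sum_strict_mono) (auto simp: not_le)
      also have "\<dots> = (\<Sum>v\<in>V. \<Sum>u\<in>V. if u \<noteq> v \<and> E u v then 1 else 0)"
        using less.prems(1) by (simp add: sum.If_cases Int_def)
      also have "\<dots> = (\<Sum>u\<in>V. \<Sum>v\<in>V. if u \<noteq> v \<and> E u v then 1 else 0)"
        by (rule sum.swap)
      also have "\<dots> = (\<Sum>u\<in>V. card {v\<in>V. v \<noteq> u \<and> E u v})"
        using less.prems(1) by (simp add: sum.If_cases Int_def eq_commute[of _ "_ :: 'a"])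
      also have "\<dots> \<le> (\<Sum>v\<in>V. d)"
        using less.prems(2) by (rule sum_mono)
      finally show False
        by simp
    qed
    then obtain v where v: "v \<in> V" "card {u\<in>V. u \<noteq> v \<and> E u v} \<le> d"
      by blast
    define N where "N = {v} \<union> {w\<in>V. w \<noteq> v \<and> E v w} \<union> {u\<in>V. u \<noteq> v \<and> E u v}"
    have "card N \<le> card {v} + card {w\<in>V. w \<noteq> v \<and> E v w} + card {u\<in>V. u \<noteq> v \<and> E u v}"
      unfolding N_def by (meson card_Un_le order_trans add_right_mono)
    hence cN: "card N \<le> 2 * d + 1"
      using v less.prems(2)[OF v(1)] by simp
    have NV: "N \<subseteq> V" "v \<in> N"
      using v by (auto simp: N_def)
    have lt: "card (V - N) < card V"
      using NV less.prems(1) by (intro psubset_card_mono) auto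
    have out: "card {w\<in>V - N. w \<noteq> u \<and> E u w} \<le> d" if "u \<in> V - N" for u
    proof -
      have "card {w\<in>V - N. w \<noteq> u \<and> E u w} \<le> card {w\<in>V. w \<noteq> u \<and> E u w}"
        using less.prems(1) by (intro card_mono) auto
      thus ?thesis
        using less.prems(2)[of u] that by simp
    qed
    obtain W where W: "W \<subseteq> V - N" "\<And>u w. u \<in> W \<Longrightarrow> w \<in> W \<Longrightarrow> u \<noteq> w \<Longrightarrow> \<not> E u w"
      "card (V - N) \<le> (2 * d + 1) * card W"
      using less.hyps[OF lt finite_Diff[OF less.prems(1)] out] by blast
    have "finite W"
      using W(1) less.prems(1) finite_subset by blast
    moreover have "v \<notin> W"
      using W(1) NV by blast
    moreover have "card V = card (V - N) + card N"
      using NV(1) less.prems(1) card_mono[OF less.prems(1) NV(1)] finite_subset[OF NV(1)]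
      by (simp add: card_Diff_subset)
    ultimately have "card V \<le> (2 * d + 1) * card (insert v W)"
      using W(3) cN by simp
    moreover have "\<not> E u w" if "u \<in> insert v W" "w \<in> insert v W" "u \<noteq> w" for u w
    proof (cases "u \<in> W \<and> w \<in> W")
      case True
      thus ?thesis using W(2) that by blast
    next
      case False
      thus ?thesis using that W(1) by (auto simp: N_def)
    qed
    ultimately show ?thesis
      using v W(1) by (intro exI[of _ "insert v W"]) auto
  qed simp
qed

section \<open>Walks in Cayley graphs\<close>

lemma eq_if_dvd_diff_residues:
  fixes x y :: int and p :: nat
  assumes "x \<in> {0..<int p}" "y \<in> {0..<int p}" "int p dvd x - y"
  shows "x = y"
proof -
  have "x mod int p = y mod int p"
    using assms(3) by (simp add: mod_eq_dvd_iff)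
  thus ?thesis
    using assms(1,2) by simp
qed

text \<open>Each injective map sends at most \<open>card F\<close> points into \<open>F\<close>, and
  \<open>B\<close> excludes at most one more.\<close>

lemma exists_avoiding:
  fixes N :: "'a set" and F :: "'b set"
  assumes "finite N" "finite F" and g: "inj_on g N" and h: "inj_on h N" and x0: "B \<subseteq> {x0}"
    and "2 * card F + 1 < card N"
  obtains z where "z \<in> N" "g z \<notin> F" "h z \<notin> F" "z \<notin> B"
proof -
  have "card {z\<in>N. g z \<in> F} \<le> card F"
    using assms(2) g by (intro card_inj_on_le[of g]) (auto simp: inj_on_def)
  moreover have "card {z\<in>N. h z \<in> F} \<le> card F"
    using assms(2) h by (intro card_inj_on_le[of h]) (auto simp: inj_on_def)
  moreover have "card B \<le> 1"
    using card_mono[OF _ x0] by simp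
  moreover have "card ({z\<in>N. g z \<in> F} \<union> {z\<in>N. h z \<in> F} \<union> B)
      \<le> card {z\<in>N. g z \<in> F} + card {z\<in>N. h z \<in> F} + card B"
    by (meson card_Un_le order_trans add_right_mono)
  ultimately have "card ({z\<in>N. g z \<in> F} \<union> {z\<in>N. h z \<in> F} \<union> B) < card N"
    using assms(6) by linarith
  moreover have "finite ({z\<in>N. g z \<in> F} \<union> {z\<in>N. h z \<in> F} \<union> B)"
    using assms(1) finite_subset[OF x0] by simp
  ultimately have "\<not> N \<subseteq> {z\<in>N. g z \<in> F} \<union> {z\<in>N. h z \<in> F} \<union> B"
    by (metis card_mono linorder_not_le)
  then obtain z where z: "z \<in> N" "z \<notin> {z\<in>N. g z \<in> F} \<union> {z\<in>N. h z \<in> F} \<union> B"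
    unfolding subset_eq by blast
  show thesis
    by (rule that[of z]) (use z in simp_all)
qed

locale cayley_bound =
  fixes p :: nat and A :: "int set" and \<alpha> :: nat
  assumes prime_p: "prime p" and A: "A \<subseteq> {0..<int p}"
    and independent_le: "\<And>I. I \<subseteq> {0..<int p} \<Longrightarrow>
      (\<And>u v. u \<in> I \<Longrightarrow> v \<in> I \<Longrightarrow> u \<noteq> v \<Longrightarrow> (v - u) mod int p \<notin> A) \<Longrightarrow> card I \<le> \<alpha>"
begin

lemma p_pos: "p > 0"
  using prime_p prime_gt_0_nat by blast

lemma prime_int_p: "prime (int p)"
  using prime_p by simp

text \<open>Modulo \<open>p\<close> this says \<open>z' = z - (b / a) * r\<close> when
  \<open>a\<close> is invertible, so the steps are the arcs of the Cayley graph of a dilate of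
  \<open>A\<close>, labelled by elements of \<open>A\<close>.\<close>

definition step :: "int \<Rightarrow> int \<Rightarrow> int \<Rightarrow> int \<Rightarrow> int \<Rightarrow> bool" where
  "step a b z r z' \<longleftrightarrow> r \<in> A \<and> int p dvd a * (z' - z) + b * r"

definition successors :: "int \<Rightarrow> int \<Rightarrow> int set \<Rightarrow> int \<Rightarrow> int set" where
  "successors a b V z = {z'\<in>V. z' \<noteq> z \<and> (\<exists>r. step a b z r z')}"

text \<open>The vertices of low out-degree span a digraph of out-degree at most \<open>d\<close>,
  which has an independent set \<open>W\<close> of proportion \<open>1 / (2 * d + 1)\<close>. A
  dilation carries \<open>W\<close> to an independent set of the Cayley graph of \<open>A\<close>,
  so \<open>card W \<le> \<alpha>\<close>.\<close>

lemma few_low_outdegree: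
  assumes a: "\<not> int p dvd a" and b: "\<not> int p dvd b" and V: "V \<subseteq> {0..<int p}"
  shows "card {z\<in>V. card (successors a b V z) \<le> d} \<le> (2 * d + 1) * \<alpha>"
proof -
  define U where "U = {z\<in>V. card (successors a b V z) \<le> d}"
  have finV: "finite V"
    using V finite_subset by blast
  have UV: "U \<subseteq> V"
    by (auto simp: U_def)
  have finU: "finite U"
    using finV UV finite_subset by blast
  have out: "card {w\<in>U. w \<noteq> v \<and> (\<exists>r. step a b v r w)} \<le> d" if "v \<in> U" for v
  proof -
    have "card {w\<in>U. w \<noteq> v \<and> (\<exists>r. step a b v r w)} \<le> card (successors a b V v)"
      using finV UV by (intro card_mono) (auto simp: successors_def)
    thus ?thesis
      using that by (simp add: U_def)
  qed
  obtain W where W: "W \<subseteq> U" "\<forall>u\<in>W. \<forall>v\<in>W. u \<noteq> v \<longrightarrow> \<not> (\<exists>r. step a b u r v)"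
    "card U \<le> (2 * d + 1) * card W"
    using exists_independent_of_bounded_outdegree[OF finU out] by blast
  have "coprime b (int p)"
    using b prime_int_p prime_imp_coprime[of "int p" b] by (simp add: coprime_commute)
  then obtain b' where b': "[b * b' = 1] (mod int p)"
    using cong_solve_coprime_int by blast
  define u where "u = - a * b'"
  have u: "int p dvd a * x + b * (u * x)" for x
  proof -
    have "int p dvd b * b' - 1"
      using b' by (simp add: cong_iff_dvd_diff)
    hence "int p dvd (b * b' - 1) * (- a * x)"
      by (rule dvd_mult2)
    also have "(b * b' - 1) * (- a * x) = a * x + b * (u * x)"
      by (simp add: u_def algebra_simps)
    finally show ?thesis .
  qed
  have up: "\<not> int p dvd u"
  proof
    assume "int p dvd u"
    hence "int p dvd b * (u * 1)"
      by simp
    hence "int p dvd a * 1"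
      using u[of 1] dvd_add_left_iff by blast
    thus False
      using a by simp
  qed
  have WV: "W \<subseteq> {0..<int p}"
    using W(1) UV V by blast
  have "inj_on (\<lambda>w. (u * w) mod int p) W"
  proof (rule inj_onI)
    fix x y assume xy: "x \<in> W" "y \<in> W" "(u * x) mod int p = (u * y) mod int p"
    have "int p dvd u * (x - y)"
      using xy(3) by (simp add: mod_eq_dvd_iff right_diff_distrib)
    hence "int p dvd x - y"
      using up prime_int_p by (simp add: prime_dvd_mult_iff)
    thus "x = y"
      using xy(1,2) WV eq_if_dvd_diff_residues by blast
  qed
  hence "card W = card ((\<lambda>w. (u * w) mod int p) ` W)"
    by (simp add: card_image)
  also have "\<dots> \<le> \<alpha>"
  proof (rule independent_le)
    show "(\<lambda>w. (u * w) mod int p) ` W \<subseteq> {0..<int p}"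
      using p_pos by auto
  next
    fix x y assume "x \<in> (\<lambda>w. (u * w) mod int p) ` W" "y \<in> (\<lambda>w. (u * w) mod int p) ` W" "x \<noteq> y"
    then obtain v w where vw: "v \<in> W" "w \<in> W" "v \<noteq> w" "x = (u * v) mod int p" "y = (u * w) mod int p"
      by blast
    have eq: "(y - x) mod int p = (u * (w - v)) mod int p"
      unfolding vw by (simp add: mod_diff_eq right_diff_distrib)
    show "(y - x) mod int p \<notin> A"
    proof
      assume A: "(y - x) mod int p \<in> A"
      have "int p dvd u * (w - v) - (y - x) mod int p"
        unfolding eq by (simp add: minus_mod_eq_mult_div)
      hence "int p dvd (a * (w - v) + b * (u * (w - v))) - b * (u * (w - v) - (y - x) mod int p)"
        by (intro dvd_diff[OF u] dvd_mult)
      also have "\<dots> = a * (w - v) + b * ((y - x) mod int p)"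
        by (simp add: algebra_simps)
      finally have "int p dvd a * (w - v) + b * ((y - x) mod int p)" .
      hence "step a b v ((y - x) mod int p) w"
        using A by (simp add: step_def)
      thus False
        using W(2) vw by blast
    qed
  qed
  finally show ?thesis
    using W(3) unfolding U_def[symmetric] by (meson le_trans mult_le_mono2)
qed

lemma step_injective:
  assumes a: "\<not> int p dvd a" and z: "z' \<in> {0..<int p}" "z'' \<in> {0..<int p}"
    and "step a b z r z'" "step a b z r z''"
  shows "z' = z''"
proof -
  have "int p dvd (a * (z' - z) + b * r) - (a * (z'' - z) + b * r)"
    using assms by (intro dvd_diff) (auto simp: step_def)
  also have "\<dots> = a * (z' - z'')"
    by (simp add: algebra_simps)
  finally have "int p dvd z' - z''"
    using a prime_int_p by (simp add: prime_dvd_mult_iff)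
  thus ?thesis
    using z eq_if_dvd_diff_residues by blast
qed

text \<open>
  From a good start \<open>z0\<close> one can walk inside \<open>V\<close>, one step for each \<open>i \<in> J\<close>, with distinct labels
  \<open>r i \<in> A\<close> that avoid any prescribed small set \<open>F\<close>.  The shift \<open>t\<close> is there because the end point \<open>z\<close>
  of the walk contributes the value \<open>z + t\<close> to the solution, which must be a new element as well.
\<close>

definition good_start ::
    "int \<Rightarrow> int \<Rightarrow> nat \<Rightarrow> ('i \<Rightarrow> int) \<Rightarrow> 'i set \<Rightarrow> int set \<Rightarrow> int \<Rightarrow> bool" where
  "good_start a t f c J V z0 \<longleftrightarrow> (\<forall>F. finite F \<longrightarrow> card F + card J \<le> f \<longrightarrow>
     (\<exists>z\<in>V. \<exists>r. r ` J \<subseteq> A - F \<and> inj_on r J \<and> (z + t) mod int p \<notin> F \<union> r ` J \<and>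
       int p dvd a * (z - z0) + (\<Sum>i\<in>J. c i * r i)))"

text \<open>Induction on \<open>J\<close>, each index costing at most
  \<open>(2 * (2 * f + 1) + 1) * \<alpha>\<close> starts. A point with more than
  \<open>2 * f + 1\<close> successors among the good starts for \<open>J\<close> can take its first
  step to one of these with a fresh label, and the walk continues from there.\<close>

lemma few_bad_starts:
  fixes c :: "'i \<Rightarrow> int"
  assumes a: "\<not> int p dvd a" and "finite J" "J \<noteq> {}" and c: "\<And>i. i \<in> J \<Longrightarrow> \<not> int p dvd c i"
    and V: "V \<subseteq> {0..<int p}" and t: "\<And>z. z \<in> V \<Longrightarrow> \<not> int p dvd z + t"
  shows "card {z\<in>V. \<not> good_start a t f c J V z} \<le> card J * ((2 * (2 * f + 1) + 1) * \<alpha>)"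
  using assms(2,3,4)
proof (induction J rule: finite_ne_induct)
  case (singleton i)
  have ci: "\<not> int p dvd c i"
    using singleton by simp
  have "good_start a t f c {i} V z0" if z0: "z0 \<in> V" and many: "2 * f + 1 < card (successors a (c i) V z0)" for z0
    unfolding good_start_def
  proof (intro allI impI)
    fix F :: "int set" assume F: "finite F" "card F + card {i} \<le> f"
    define N where "N = successors a (c i) V z0"
    have finN: "finite N"
      using V finite_subset[of V "{0..<int p}"] by (simp add: N_def successors_def)
    have NV: "N \<subseteq> {0..<int p}"
      using V by (auto simp: N_def successors_def)
    have "\<forall>z\<in>N. \<exists>r. step a (c i) z0 r z"
      by (simp add: N_def successors_def)
    then obtain \<rho> where \<rho>: "\<And>z. z \<in> N \<Longrightarrow> step a (c i) z0 (\<rho> z) z"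
      by metis
    have inj\<rho>: "inj_on \<rho> N"
    proof (rule inj_onI)
      fix x y assume "x \<in> N" "y \<in> N" "\<rho> x = \<rho> y"
      thus "x = y"
        using \<rho>[of x] \<rho>[of y] NV a step_injective by (metis subsetD)
    qed
    have injt: "inj_on (\<lambda>z. (z + t) mod int p) N"
    proof (rule inj_onI)
      fix x y assume xy: "x \<in> N" "y \<in> N" "(x + t) mod int p = (y + t) mod int p"
      hence "int p dvd x - y"
        by (simp add: mod_eq_dvd_iff)
      thus "x = y"
        using xy NV eq_if_dvd_diff_residues by blast
    qed
    have eqt: "int p dvd a * (z - z0) + c i * (z + t)" if "z \<in> N" "\<rho> z = (z + t) mod int p" for z
    proof -
      have "int p dvd a * (z - z0) + c i * ((z + t) mod int p)"
        using \<rho>[OF that(1)] that(2) by (simp add: step_def)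
      moreover have "int p dvd c i * ((z + t) - (z + t) mod int p)"
        by (intro dvd_mult) (simp add: minus_mod_eq_mult_div)
      ultimately have "int p dvd (a * (z - z0) + c i * ((z + t) mod int p)) +
          c i * ((z + t) - (z + t) mod int p)"
        by (rule dvd_add)
      also have "\<dots> = a * (z - z0) + c i * (z + t)"
        by (simp add: algebra_simps)
      finally show ?thesis .
    qed
    \<comment> \<open>At most one end point coincides with its own label: two of them would force
      \<open>a + c i\<close> to vanish modulo \<open>p\<close>, and then \<open>a * (z0 + t)\<close>
      as well, against the hypothesis on \<open>t\<close>.\<close>
    have "\<exists>x0. {z\<in>N. \<rho> z = (z + t) mod int p} \<subseteq> {x0}"
    proof (rule ccontr)
      assume no: "\<not> ?thesis"
      then obtain x where x: "x \<in> N" "\<rho> x = (x + t) mod int p"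
        by blast
      then obtain y where y: "y \<in> N" "\<rho> y = (y + t) mod int p" "y \<noteq> x"
        using no by blast
      have "int p dvd (a * (x - z0) + c i * (x + t)) - (a * (y - z0) + c i * (y + t))"
        using eqt x y by (intro dvd_diff) auto
      also have "\<dots> = (a + c i) * (x - y)"
        by (simp add: algebra_simps)
      finally have "int p dvd a + c i \<or> int p dvd x - y"
        using prime_int_p by (simp add: prime_dvd_mult_iff)
      moreover have "\<not> int p dvd x - y"
        using eq_if_dvd_diff_residues x y NV by blast
      ultimately have "int p dvd (a + c i) * (x + t)"
        by simp
      with eqt[OF x] have "int p dvd (a + c i) * (x + t) - (a * (x - z0) + c i * (x + t))"
        by (intro dvd_diff)
      also have "\<dots> = a * (z0 + t)"
        by (simp add: algebra_simps)
      finally show False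
        using a t[OF z0] prime_int_p by (simp add: prime_dvd_mult_iff)
    qed
    then obtain x0 where "{z\<in>N. \<rho> z = (z + t) mod int p} \<subseteq> {x0}"
      by blast
    moreover have "2 * card F + 1 < card N"
      using many F by (simp add: N_def)
    ultimately obtain z where z: "z \<in> N" "\<rho> z \<notin> F" "(z + t) mod int p \<notin> F"
      "z \<notin> {z\<in>N. \<rho> z = (z + t) mod int p}"
      by (rule exists_avoiding[OF finN F(1) inj\<rho> injt])
    have "z \<in> V"
      using z(1) by (simp add: N_def successors_def)
    moreover have "\<rho> z \<in> A" "int p dvd a * (z - z0) + c i * \<rho> z"
      using \<rho>[OF z(1)] by (auto simp: step_def)
    ultimately show "\<exists>z\<in>V. \<exists>r. r ` {i} \<subseteq> A - F \<and> inj_on r {i} \<and> (z + t) mod int p \<notin> F \<union> r ` {i} \<and>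
       int p dvd a * (z - z0) + (\<Sum>i\<in>{i}. c i * r i)"
      using z by (intro bexI[of _ z] exI[of _ "\<lambda>_. \<rho> z"]) auto
  qed
  hence "{z\<in>V. \<not> good_start a t f c {i} V z} \<subseteq> {z\<in>V. card (successors a (c i) V z) \<le> 2 * f + 1}"
    by (auto simp: not_le[symmetric])
  hence "card {z\<in>V. \<not> good_start a t f c {i} V z} \<le> card {z\<in>V. card (successors a (c i) V z) \<le> 2 * f + 1}"
    using V finite_subset[of V "{0..<int p}"] by (intro card_mono) auto
  also have "\<dots> \<le> (2 * (2 * f + 1) + 1) * \<alpha>"
    by (rule few_low_outdegree[OF a ci V])
  finally show ?case
    by simp
next
  case (insert i J)
  have finV: "finite V"
    using V finite_subset by blast
  have ci: "\<not> int p dvd c i"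
    using insert.prems by simp
  define W where "W = {z\<in>V. good_start a t f c J V z}"
  have WV: "W \<subseteq> {0..<int p}"
    using V by (auto simp: W_def)
  have "good_start a t f c (insert i J) V z0"
    if z0: "z0 \<in> W" and many: "2 * f + 1 < card (successors a (c i) W z0)" for z0
    unfolding good_start_def
  proof (intro allI impI)
    fix F :: "int set" assume F: "finite F" "card F + card (insert i J) \<le> f"
    define N where "N = successors a (c i) W z0"
    have finN: "finite N"
      using finV by (simp add: N_def successors_def W_def)
    have NV: "N \<subseteq> {0..<int p}"
      using WV by (auto simp: N_def successors_def)
    have "\<forall>z\<in>N. \<exists>r. step a (c i) z0 r z"
      by (simp add: N_def successors_def)
    then obtain \<rho> where \<rho>: "\<And>z. z \<in> N \<Longrightarrow> step a (c i) z0 (\<rho> z) z"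
      by metis
    have inj\<rho>: "inj_on \<rho> N"
    proof (rule inj_onI)
      fix x y assume "x \<in> N" "y \<in> N" "\<rho> x = \<rho> y"
      thus "x = y"
        using \<rho>[of x] \<rho>[of y] NV a step_injective by (metis subsetD)
    qed
    have "2 * card F + 1 < card N"
      using many F by (simp add: N_def)
    \<comment> \<open>At an intermediate point only the label has to avoid \<open>F\<close>, so both
      maps are taken to be \<rho>.\<close>
    then obtain z1 where z1: "z1 \<in> N" "\<rho> z1 \<notin> F"
      using exists_avoiding[OF finN F(1) inj\<rho> inj\<rho>, of "{}"] by blast
    have "good_start a t f c J V z1"
      using z1(1) by (simp add: N_def successors_def W_def)
    \<comment> \<open>The label just used becomes forbidden while one index is dealt with, so the
      budget \<open>f\<close> is kept.\<close>
    moreover have "card (insert (\<rho> z1) F) + card J \<le> f"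
      using F insert.hyps z1 by simp
    ultimately obtain z r where z: "z \<in> V" "r ` J \<subseteq> A - insert (\<rho> z1) F" "inj_on r J"
        "(z + t) mod int p \<notin> insert (\<rho> z1) F \<union> r ` J"
        "int p dvd a * (z - z1) + (\<Sum>i\<in>J. c i * r i)"
      unfolding good_start_def using F(1) by (meson finite_insert)
    define r' where "r' = r(i := \<rho> z1)"
    have r'J: "r' j = r j" if "j \<in> J" for j
      using insert.hyps that by (auto simp: r'_def)
    have r': "r' i = \<rho> z1" "r' ` J = r ` J" "inj_on r' J" "(\<Sum>i\<in>J. c i * r' i) = (\<Sum>i\<in>J. c i * r i)"
      using r'J z(3) inj_on_cong[of J r' r] by (simp_all add: r'_def)
    have st: "\<rho> z1 \<in> A" "int p dvd a * (z1 - z0) + c i * \<rho> z1"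
      using \<rho>[OF z1(1)] by (auto simp: step_def)
    have "r' ` insert i J \<subseteq> A - F"
      using r'(1,2) st(1) z1(2) z(2) by auto
    moreover have "inj_on r' (insert i J)"
      using r'(1-3) z(2) by (auto simp: inj_on_insert)
    moreover have "(z + t) mod int p \<notin> F \<union> r' ` insert i J"
      using r'(1,2) z(4) by auto
    moreover have "int p dvd (a * (z - z1) + (\<Sum>i\<in>J. c i * r i)) + (a * (z1 - z0) + c i * \<rho> z1)"
      using z(5) st(2) by (rule dvd_add)
    hence "int p dvd a * (z - z0) + (\<Sum>i\<in>insert i J. c i * r' i)"
      using insert.hyps r' by (simp add: algebra_simps)
    ultimately show "\<exists>z\<in>V. \<exists>r. r ` insert i J \<subseteq> A - F \<and> inj_on r (insert i J) \<and>
        (z + t) mod int p \<notin> F \<union> r ` insert i J \<and>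
        int p dvd a * (z - z0) + (\<Sum>i\<in>insert i J. c i * r i)"
      using z(1) by blast
  qed
  hence "{z\<in>V. \<not> good_start a t f c (insert i J) V z} \<subseteq>
      {z\<in>V. \<not> good_start a t f c J V z} \<union> {z\<in>W. card (successors a (c i) W z) \<le> 2 * f + 1}"
    by (auto simp: not_le[symmetric] W_def)
  hence "card {z\<in>V. \<not> good_start a t f c (insert i J) V z} \<le>
      card ({z\<in>V. \<not> good_start a t f c J V z} \<union> {z\<in>W. card (successors a (c i) W z) \<le> 2 * f + 1})"
    using finV by (intro card_mono) (auto simp: W_def)
  also have "\<dots> \<le> card {z\<in>V. \<not> good_start a t f c J V z} +
      card {z\<in>W. card (successors a (c i) W z) \<le> 2 * f + 1}"
    by (rule card_Un_le)
  also have "\<dots> \<le> card J * ((2 * (2 * f + 1) + 1) * \<alpha>) + (2 * (2 * f + 1) + 1) * \<alpha>"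
    using insert.prems by (intro add_mono insert.IH few_low_outdegree[OF a ci WV]) auto
  finally show ?case
    using insert.hyps by simp
qed

end

section \<open>Solutions from popular patterns and walks\<close>

text \<open>The starts of popular patterns outnumber those from which no suitable walk exists,
  provided that \<alpha> is a small multiple of \<open>p\<close>; any remaining start yields a
  solution.\<close>

lemma exists_solution:
  fixes c :: "'i \<Rightarrow> int" and \<delta> :: real
  assumes K: "finite K" "card K \<ge> 3" and nz: "\<And>i. i \<in> K \<Longrightarrow> c i \<noteq> 0"
    and S: "S \<noteq> {}" "S \<subseteq> K" "(\<Sum>s\<in>S. c s) = 0" and \<delta>: "\<delta> > 0"
  obtains \<epsilon> :: real and P :: nat where "\<epsilon> > 0"
    "\<And>p A \<alpha>. p \<ge> P \<Longrightarrow> cayley_bound p A \<alpha> \<Longrightarrow> real \<alpha> \<le> \<epsilon> * real p \<Longrightarrow>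
      \<delta> * real p \<le> real (card A) \<Longrightarrow>
      \<exists>a. a ` K \<subseteq> A \<and> inj_on a K \<and> int p dvd (\<Sum>i\<in>K. c i * a i)"
proof -
  have finS: "finite S"
    using S(2) K(1) finite_subset by blast
  obtain s0 where s0: "s0 \<in> S"
    using S(1) by blast
  have cS: "card S \<ge> 2"
  proof (rule ccontr)
    assume "\<not> card S \<ge> 2"
    moreover have "card S \<noteq> 0"
      using finS S(1) by simp
    ultimately have "card S = 1"
      by linarith
    hence "S = {s0}"
      using s0 by (auto simp: card_1_singleton_iff)
    thus False
      using S(3) nz[of s0] s0 S(2) by auto
  qed
  obtain \<delta>' :: real and N :: nat where \<delta>': "\<delta>' > 0" and pattern:
    "\<And>p A. p > 0 \<Longrightarrow> A \<subseteq> {0..<int p} \<Longrightarrow> \<delta> * real p \<le> real (card A) \<Longrightarrow>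
      \<exists>t. t ` S \<subseteq> {0..<int N} \<and> (card S \<ge> 3 \<longrightarrow> inj_on t S) \<and> (\<Sum>s\<in>S. c s * t s) = 0 \<and>
        \<delta>' * real p \<le> real (card {z\<in>{0..<int p}. \<forall>s\<in>S. (z + t s) mod int p \<in> A})"
  proof (rule popular_zero_sum_pattern[OF finS cS _ S(3) \<delta>])
    show "c s \<noteq> 0" if "s \<in> S" for s
      using nz that S(2) by blast
  qed (rule that)
  define J where "J = K - S"
  \<comment> \<open>Room for the pattern values in \<open>F\<close> and the labels indexed by
    \<open>J\<close>, at most \<open>card K\<close> each. With \<open>L\<close> and \<epsilon>
    below, the bad starts number at most
    \<open>L * \<alpha> \<le> \<delta>' * p / 2\<close>.\<close>
  define f where "f = 2 * card K"
  define L where "L = card K * (2 * (2 * f + 1) + 1)"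
  have L: "L > 0"
    using K by (simp add: L_def)
  define \<epsilon> where "\<epsilon> = \<delta>' / (2 * real L)"
  have \<epsilon>: "\<epsilon> > 0"
    using \<delta>' L by (simp add: \<epsilon>_def)
  \<comment> \<open>Beyond \<open>P\<close> the values of \<open>t\<close> are residues modulo
    \<open>p\<close>, no coefficient is divisible by \<open>p\<close>, and
    \<open>\<delta>' * p \<ge> 3\<close>, so that \<open>\<delta>' * p - 1\<close> exceeds the
    number of bad starts.\<close>
  define P where "P = N + nat (\<Sum>i\<in>K. \<bar>c i\<bar>) + nat \<lceil>3 / \<delta>'\<rceil> + 1"
  have "\<exists>a. a ` K \<subseteq> A \<and> inj_on a K \<and> int p dvd (\<Sum>i\<in>K. c i * a i)"
    if p: "p \<ge> P" and cb: "cayley_bound p A \<alpha>" and \<alpha>: "real \<alpha> \<le> \<epsilon> * real p"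
      and dense: "\<delta> * real p \<le> real (card A)" for p A \<alpha>
  proof -
    interpret cayley_bound p A \<alpha>
      by (rule cb)
    have pN: "p \<ge> N"
      using p by (simp add: P_def)
    have ndvd: "\<not> int p dvd c i" if "i \<in> K" for i
    proof
      assume "int p dvd c i"
      hence "int p \<le> \<bar>c i\<bar>"
        using dvd_imp_le_int[OF nz[OF that], of "int p"] by simp
      also have "\<dots> \<le> (\<Sum>i\<in>K. \<bar>c i\<bar>)"
        using that K(1) by (intro member_le_sum) auto
      finally show False
        using p by (simp add: P_def)
    qed
    obtain t where t: "t ` S \<subseteq> {0..<int N}" "card S \<ge> 3 \<longrightarrow> inj_on t S" "(\<Sum>s\<in>S. c s * t s) = 0"
      and cI: "\<delta>' * real p \<le> real (card {z\<in>{0..<int p}. \<forall>s\<in>S. (z + t s) mod int p \<in> A})"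
      using pattern[OF p_pos A dense] by (elim exE conjE) (rule that)
    define I where "I = {z\<in>{0..<int p}. \<forall>s\<in>S. (z + t s) mod int p \<in> A}"
    have finI: "finite I"
      by (rule finite_subset[of _ "{0..<int p}"]) (auto simp: I_def)
    have IA: "(z + t s) mod int p \<in> A" if "z \<in> I" "s \<in> S" for z s
      using that by (simp add: I_def)
    have t_mod: "(z + t s) mod int p = (z + t s') mod int p \<longleftrightarrow> t s = t s'" if "s \<in> S" "s' \<in> S" for z s s'
    proof -
      have "t s \<in> {0..<int p}" "t s' \<in> {0..<int p}"
        using t(1) pN that by (auto simp: image_subset_iff)
      thus ?thesis
        using eq_if_dvd_diff_residues[of "t s" p "t s'"] by (auto simp: mod_eq_dvd_iff)
    qed
    have sum_t: "(\<Sum>s\<in>S. c s * (z + t s)) = 0" for z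
      using t(3) S(3) by (simp add: distrib_left sum.distrib sum_distrib_right[symmetric])
    have p2: "\<delta>' * real p \<ge> 3"
    proof -
      have "3 / \<delta>' \<le> real p"
        using p unfolding P_def by linarith
      thus ?thesis
        using \<delta>' by (simp add: field_simps)
    qed
    have mod_dvd: "int p dvd c i * (x mod int p) - c i * x" for i x
      by (metis dvd_mult mod_eq_dvd_iff mod_mod_trivial right_diff_distrib)
    show ?thesis
    proof (cases "J = {}")
      \<comment> \<open>When \<open>S\<close> is all of \<open>K\<close>, no walk is required: any
        translate of the pattern inside \<open>A\<close> is a solution, with distinct values as
        \<open>card S \<ge> 3\<close>.\<close>
      case True
      hence KS: "K = S"
        using S(2) by (auto simp: J_def)
      have "card I \<noteq> 0"
        using cI p2 unfolding I_def by auto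
      then obtain z where z: "z \<in> I"
        by fastforce
      have "(\<lambda>s. (z + t s) mod int p) ` K \<subseteq> A"
        using IA[OF z] KS by auto
      moreover have "inj_on (\<lambda>s. (z + t s) mod int p) K"
        using t(2) K(2) t_mod unfolding KS by (auto simp: inj_on_def)
      moreover have "int p dvd (\<Sum>i\<in>S. c i * ((z + t i) mod int p) - c i * (z + t i))"
        by (intro dvd_sum mod_dvd)
      hence "int p dvd (\<Sum>i\<in>K. c i * ((z + t i) mod int p))"
        unfolding KS sum_subtractf sum_t by simp
      ultimately show ?thesis
        by (intro exI[of _ "\<lambda>s. (z + t s) mod int p"] conjI)
    next
      case False
      \<comment> \<open>At most one start has \<open>z + t s0\<close> divisible by \<open>p\<close>;
        it is discarded to meet the hypothesis of \<open>few_bad_starts\<close>.\<close>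
      define V where "V = {z\<in>I. \<not> int p dvd z + t s0}"
      have V: "V \<subseteq> {0..<int p}" "\<And>z. z \<in> V \<Longrightarrow> \<not> int p dvd z + t s0"
        by (auto simp: V_def I_def)
      have "card (I - V) \<le> 1"
      proof -
        have "x = y" if "x \<in> I - V" "y \<in> I - V" for x y
        proof -
          have "int p dvd (x + t s0) - (y + t s0)"
            using that by (intro dvd_diff) (auto simp: V_def)
          thus ?thesis
            using that eq_if_dvd_diff_residues[of x p y] by (simp add: I_def)
        qed
        thus ?thesis
          using finI by (simp add: card_le_Suc0_iff_eq)
      qed
      moreover have "card I = card V + card (I - V)"
        using finI by (subst card_Un_disjoint[symmetric]) (auto simp: V_def intro: arg_cong[where f = card])
      ultimately have "real (card I) \<le> real (card V) + 1"
        by linarith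
      hence cV: "\<delta>' * real p - 1 \<le> real (card V)"
        using cI unfolding I_def by linarith
      have "card {z\<in>V. \<not> good_start (c s0) (t s0) f c J V z} \<le> card J * ((2 * (2 * f + 1) + 1) * \<alpha>)"
        using False K(1) ndvd s0 S(2) V by (intro few_bad_starts) (auto simp: J_def)
      also have "\<dots> \<le> card K * ((2 * (2 * f + 1) + 1) * \<alpha>)"
        using K(1) by (intro mult_le_mono1 card_mono) (auto simp: J_def)
      also have "\<dots> = L * \<alpha>"
        by (simp add: L_def algebra_simps)
      finally have "real (card {z\<in>V. \<not> good_start (c s0) (t s0) f c J V z}) \<le> real L * real \<alpha>"
        by (metis of_nat_le_iff of_nat_mult)
      also have "\<dots> \<le> real L * (\<epsilon> * real p)"
        using \<alpha> by (intro mult_left_mono) auto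
      also have "\<dots> = \<delta>' * real p / 2"
        using L by (simp add: \<epsilon>_def)
      finally have "card {z\<in>V. \<not> good_start (c s0) (t s0) f c J V z} \<noteq> card V"
        using cV p2 by linarith
      hence "{z\<in>V. \<not> good_start (c s0) (t s0) f c J V z} \<noteq> V"
        by metis
      then obtain z0 where z0: "z0 \<in> V" "good_start (c s0) (t s0) f c J V z0"
        by blast
      \<comment> \<open>\<open>x s0\<close> comes from the end point \<open>z\<close> of the walk and the other \<open>x s\<close> from its start \<open>z0\<close>;
        since \<open>c\<close> sums to \<open>0\<close> over \<open>S\<close>, this leaves \<open>c s0 * (z - z0)\<close>, which the labels cancel.\<close>
      define F where "F = (\<lambda>s. (z0 + t s) mod int p) ` (S - {s0})"
      have finF: "finite F"
        using finS by (simp add: F_def)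
      have "card F \<le> card K"
        unfolding F_def using card_image_le[of "S - {s0}"] card_mono[OF K(1), of "S - {s0}"] finS S(2)
        by (meson Diff_subset finite_Diff le_trans subset_trans)
      moreover have "card J \<le> card K"
        using K(1) by (intro card_mono) (auto simp: J_def)
      ultimately have "card F + card J \<le> f"
        by (simp add: f_def)
      with z0(2) finF have "\<exists>z\<in>V. \<exists>r. r ` J \<subseteq> A - F \<and> inj_on r J \<and>
          (z + t s0) mod int p \<notin> F \<union> r ` J \<and> int p dvd c s0 * (z - z0) + (\<Sum>i\<in>J. c i * r i)"
        unfolding good_start_def by simp
      then obtain z r where z: "z \<in> V" and r: "r ` J \<subseteq> A - F" "inj_on r J"
        and zt: "(z + t s0) mod int p \<notin> F \<union> r ` J"
        and eq: "int p dvd c s0 * (z - z0) + (\<Sum>i\<in>J. c i * r i)"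
        by (elim bexE exE conjE) (rule that)
      define y where "y s = (if s = s0 then z + t s else z0 + t s)" for s
      define a where "a i = (if i \<in> S then y i mod int p else r i)" for i
      have aJ: "a i = r i" if "i \<in> J" for i
        using that by (simp add: a_def J_def)
      have a0: "a s0 = (z + t s0) mod int p"
        using s0 by (simp add: a_def y_def)
      have aS: "a s = (z0 + t s) mod int p" if "s \<in> S - {s0}" for s
        using that by (simp add: a_def y_def)
      have aF: "a ` (S - {s0}) = F"
        unfolding F_def using aS by (intro image_cong) auto
      have K_eq: "K = insert s0 ((S - {s0}) \<union> J)"
        using s0 S(2) by (auto simp: J_def)
      have VI: "V \<subseteq> I"
        by (auto simp: V_def)
      have "inj_on a (S - {s0})"
      proof (cases "card S \<ge> 3")
        case True
        hence "inj_on t (S - {s0})"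
          using t(2) inj_on_subset by blast
        thus ?thesis
          using aS t_mod by (auto simp: inj_on_def)
      next
        \<comment> \<open>Here \<open>S\<close> has two elements and only one of them is
          left.\<close>
        case False
        hence "card (S - {s0}) \<le> Suc 0"
          using s0 finS by simp
        thus ?thesis
          using finS card_le_Suc0_iff_eq[of "S - {s0}"] by (auto simp: inj_on_def)
      qed
      moreover have "inj_on a J"
        using r(2) aJ by (simp add: inj_on_def)
      moreover have aJr: "a ` J = r ` J"
        using aJ by (intro image_cong) auto
      moreover have "F \<inter> r ` J = {}"
        using r(1) by blast
      ultimately have "inj_on a ((S - {s0}) \<union> J)"
        unfolding inj_on_Un aF[symmetric] by blast
      moreover have "a s0 \<notin> a ` ((S - {s0}) \<union> J)"
        unfolding image_Un aF aJr a0 by (rule zt)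
      ultimately have "inj_on a K"
        unfolding K_eq inj_on_insert by (intro conjI) (assumption, blast)
      moreover have "a ` K \<subseteq> A"
      proof -
        have "F \<subseteq> A"
          using IA[of z0] z0(1) VI by (auto simp: F_def)
        moreover have "a s0 \<in> A"
          unfolding a0 using z VI s0 by (intro IA) auto
        ultimately show ?thesis
          unfolding K_eq image_insert image_Un aF aJr using r(1) by blast
      qed
      moreover have "int p dvd (\<Sum>i\<in>K. c i * a i)"
      proof -
        have "(\<Sum>s\<in>S. c s * y s) = (\<Sum>s\<in>S. c s * (z0 + t s) + (if s = s0 then c s * (z - z0) else 0))"
          by (rule sum.cong) (auto simp: y_def algebra_simps)
        also have "\<dots> = c s0 * (z - z0)"
          using finS s0 sum_t[of z0] by (simp add: sum.distrib)
        finally have y: "(\<Sum>s\<in>S. c s * y s) = c s0 * (z - z0)" .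
        have "(\<Sum>i\<in>K. c i * a i) = (\<Sum>s\<in>S. c s * a s) + (\<Sum>i\<in>J. c i * a i)"
          unfolding J_def using K(1) S(2) by (metis add.commute sum.subset_diff)
        also have "(\<Sum>i\<in>J. c i * a i) = (\<Sum>i\<in>J. c i * r i)"
          using aJ by (intro sum.cong) auto
        also have "(\<Sum>s\<in>S. c s * a s) = (\<Sum>s\<in>S. c s * (y s mod int p) - c s * y s) + c s0 * (z - z0)"
          unfolding sum_subtractf y by (simp add: a_def)
        finally have "(\<Sum>i\<in>K. c i * a i) = (\<Sum>s\<in>S. c s * (y s mod int p) - c s * y s) +
            (c s0 * (z - z0) + (\<Sum>i\<in>J. c i * r i))"
          by simp
        moreover have "int p dvd (\<Sum>s\<in>S. c s * (y s mod int p) - c s * y s)"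
          by (intro dvd_sum mod_dvd)
        ultimately show ?thesis
          using eq by simp
      qed
      ultimately show ?thesis
        by blast
    qed
  qed
  thus thesis
    by (rule that[OF \<epsilon>])
qed

theorem theorem1p2:
  fixes k :: nat and c :: "nat \<Rightarrow> int"
  assumes "k \<ge> 3"
    and "\<And>i. i \<in> {1..k} \<Longrightarrow> c i \<noteq> 0"
  shows "(\<forall>\<delta>::real. \<delta> > 0 \<longrightarrow>
            (\<exists>\<epsilon>::real. \<epsilon> > 0 \<and> solution_free_density k c \<epsilon> < ereal \<delta>))
         \<longleftrightarrow> (\<exists>S. S \<noteq> {} \<and> S \<subseteq> {1..k} \<and> (\<Sum>s\<in>S. c s) = 0)"
proof
  assume small: "\<forall>\<delta>::real. \<delta> > 0 \<longrightarrow>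
      (\<exists>\<epsilon>::real. \<epsilon> > 0 \<and> solution_free_density k c \<epsilon> < ereal \<delta>)"
  show "\<exists>S. S \<noteq> {} \<and> S \<subseteq> {1..k} \<and> (\<Sum>s\<in>S. c s) = 0"
  proof (rule ccontr)
    assume no: "\<not> ?thesis"
    have "\<exists>\<delta>>0. \<forall>\<epsilon>>0. ereal \<delta> \<le> solution_free_density k c \<epsilon>"
    proof (rule solution_free_density_bounded_below)
      show "(\<Sum>i\<in>T. c i) \<noteq> 0" if "T \<subseteq> {1..k}" "T \<noteq> {}" for T
        using no that by blast
    qed (use assms(1) in simp)
    then obtain \<delta> :: real where \<delta>: "\<delta> > 0" "\<And>\<epsilon>. \<epsilon> > 0 \<Longrightarrow> ereal \<delta> \<le> solution_free_density k c \<epsilon>"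
      by blast
    obtain \<epsilon> :: real where "\<epsilon> > 0" "solution_free_density k c \<epsilon> < ereal \<delta>"
      using small \<delta>(1) by blast
    thus False
      using \<delta>(2)[of \<epsilon>] by simp
  qed
next
  assume "\<exists>S. S \<noteq> {} \<and> S \<subseteq> {1..k} \<and> (\<Sum>s\<in>S. c s) = 0"
  then obtain S where S: "S \<noteq> {}" "S \<subseteq> {1..k}" "(\<Sum>s\<in>S. c s) = 0"
    by blast
  have k: "card {1..k} \<ge> 3"
    using assms(1) by simp
  show "\<forall>\<delta>::real. \<delta> > 0 \<longrightarrow> (\<exists>\<epsilon>::real. \<epsilon> > 0 \<and> solution_free_density k c \<epsilon> < ereal \<delta>)"
  proof (intro allI impI)
    fix \<delta> :: real
    assume \<delta>: "\<delta> > 0"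
    \<comment> \<open>Half of \<delta> is aimed at, since the \<open>Limsup\<close> inherits only a
      non-strict bound.\<close>
    hence \<delta>2: "\<delta> / 2 > 0"
      by simp
    obtain \<epsilon> :: real and P :: nat where \<epsilon>: "\<epsilon> > 0" and sol:
      "\<And>p A \<alpha>. p \<ge> P \<Longrightarrow> cayley_bound p A \<alpha> \<Longrightarrow> real \<alpha> \<le> \<epsilon> * real p \<Longrightarrow>
        \<delta> / 2 * real p \<le> real (card A) \<Longrightarrow>
        \<exists>a. a ` {1..k} \<subseteq> A \<and> inj_on a {1..k} \<and> int p dvd (\<Sum>i\<in>{1..k}. c i * a i)"
      by (rule exists_solution[OF finite_atLeastAtMost k assms(2) S \<delta>2]) (assumption, rule that)
    have le: "real (max_solution_free k c \<epsilon> p) \<le> \<delta> / 2 * real p" if p: "prime p" "p \<ge> P" for p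
    proof (rule max_solution_free_upper)
      fix A
      assume A: "A \<subseteq> {0..<int p}" "solution_free k c p A"
        "real (independence_number (with_proj (cayley_digraph p A))) \<le> \<epsilon> * real p"
      have cb: "cayley_bound p A (independence_number (with_proj (cayley_digraph p A)))"
      proof
        show "card I \<le> independence_number (with_proj (cayley_digraph p A))"
          if "I \<subseteq> {0..<int p}"
            "\<And>u v. u \<in> I \<Longrightarrow> v \<in> I \<Longrightarrow> u \<noteq> v \<Longrightarrow> (v - u) mod int p \<notin> A" for I
          using that by (rule card_le_independence_number_cayley)
      qed (rule p(1), rule A(1))
      show "real (card A) \<le> \<delta> / 2 * real p"
      proof (rule ccontr)
        assume "\<not> ?thesis"
        hence "\<delta> / 2 * real p \<le> real (card A)"
          by linarith
        from sol[OF p(2) cb A(3) this] obtain a where a: "a ` {1..k} \<subseteq> A" "inj_on a {1..k}"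
          "int p dvd (\<Sum>i\<in>{1..k}. c i * a i)"
          by (elim exE conjE) (rule that)
        have "[(\<Sum>i\<in>{1..k}. c i * a i) = 0] (mod int p)"
          using a(3) by (simp only: cong_0_iff)
        moreover have "\<forall>i\<in>{1..k}. a i \<in> A"
          using a(1) by blast
        ultimately show False
          using A(2) a(2) unfolding solution_free_def by blast
      qed
    qed (use \<delta> in simp)
    have "eventually (\<lambda>p. ereal (real (max_solution_free k c \<epsilon> p) / real p) \<le> ereal (\<delta> / 2))
        (inf sequentially (principal {p. prime p}))"
      unfolding eventually_inf_principal
      using eventually_ge_at_top[of P]
    proof (rule eventually_mono)
      fix p :: nat
      assume "p \<ge> P"
      show "p \<in> {p. prime p} \<longrightarrow> ereal (real (max_solution_free k c \<epsilon> p) / real p) \<le> ereal (\<delta> / 2)"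
      proof
        assume "p \<in> {p. prime p}"
        hence "prime p"
          by simp
        thus "ereal (real (max_solution_free k c \<epsilon> p) / real p) \<le> ereal (\<delta> / 2)"
          using le[OF _ \<open>p \<ge> P\<close>] prime_gt_0_nat[of p] by (simp add: field_simps)
      qed
    qed
    hence "solution_free_density k c \<epsilon> \<le> ereal (\<delta> / 2)"
      unfolding solution_free_density_def by (rule Limsup_bounded)
    also have "\<dots> < ereal \<delta>"
      using \<delta> by simp
    finally show "\<exists>\<epsilon>::real. \<epsilon> > 0 \<and> solution_free_density k c \<epsilon> < ereal \<delta>"
      using \<epsilon> by blast
  qed
qed

end
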